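(* Let $\phi$, $F$ and $j$ satisfy the standing assumptions stated in the context, and let $d_N^1:=\{(x,x):x\in\mathbb{R}^N\}$. Assume that $j|_{d_N^1}\equiv0$ and that $j|_{D(j)}$ is bounded. If $\nabla_uF$ is bounded on $[0,T]\times\mathbb{R}^N$ and $$\lim_{|x|\to\infty}\int_0^TF(t,x)\,dt=+\infty,$$ then the boundary value problem $$-[\phi(u')]'=\nabla_uF(t,u)\ \text{ in }[0,T],\qquad \big(\phi(u')(0),-\phi(u')(T)\big)\in\partial j(u(0),u(T))$$ has at least one solution.
   Context: $N\ge 1$ is an integer, $T>0$, $0<a<\infty$; $|\cdot|$ is the Euclidean norm on $\mathbb{R}^N$; $B_a$ is the open ball of radius $a$ centered at $0$. Standing assumptions. (1) $\phi$ is a homeomorphism from $B_a$ onto $\mathbb{R}^N$ with $\phi(0)=0$ and $\phi=\nabla\Phi$ on $B_a$, where $\Phi:\overline{B}_a\to(-\infty,0]$ is of class $C^1$ on $B_a$, and continuous and strictly convex on $\overline{B}_a$. (2) $F=F(t,u):[0,T]\times\mathbb{R}^N\to\mathbb{R}$ is continuous, $\nabla_uF$ exists and is continuous on $[0,T]\times\mathbb{R}^N$, and $F(\cdot,0)=0$. (3) $j:\mathbb{R}^N\times\mathbb{R}^N\to(-\infty,+\infty]$ is proper, convex, lower semicontinuous, $j(0)=0$ and $0\in\partial j(0)$, where $\partial j$ is the subdifferential of convex analysis. $D(j)=\{z:j(z)<+\infty\}$. A solution of the boundary value problem is a function $u\in C^1([0,T];\mathbb{R}^N)$ with $|u'(t)|<a$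 for all $t\in[0,T]$, $\phi(u')\in C^1([0,T];\mathbb{R}^N)$, $(u(0),u(T))\in D(\partial j)=\{z:\partial j(z)\ne\emptyset\}$, satisfying the system and the boundary condition; $\phi(u')(t)=\phi(u'(t))$. *)

theory Defs
  imports "HOL-Analysis.Analysis"
begin

definition strictly_convex_on :: "'a::real_vector set \<Rightarrow> ('a \<Rightarrow> real) \<Rightarrow> bool"
  where "strictly_convex_on S f \<longleftrightarrow> convex S \<and>
    (\<forall>x\<in>S. \<forall>y\<in>S. \<forall>s>0. \<forall>t>0. x \<noteq> y \<and> s + t = 1 \<longrightarrow>
       f (s *\<^sub>R x + t *\<^sub>R y) < s * f x + t * f y)"

definition effective_domain :: "('a \<Rightarrow> ereal) \<Rightarrow> 'a set"
  where "effective_domain f = {x. f x < \<infinity>}"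

definition proper_fun :: "('a \<Rightarrow> ereal) \<Rightarrow> bool"
  where "proper_fun f \<longleftrightarrow> (\<forall>x. f x \<noteq> -\<infinity>) \<and> effective_domain f \<noteq> {}"

text \<open>Convexity of an extended-real function. The weights are strictly positive, so the
  convention \<open>0 * \<infinity> = 0\<close> plays no role; for functions that avoid \<open>-\<infinity>\<close> the right-hand
  side is unambiguous.\<close>

definition ereal_convex :: "('a::real_vector \<Rightarrow> ereal) \<Rightarrow> bool"
  where "ereal_convex f \<longleftrightarrow>
    (\<forall>x y. \<forall>s>0. \<forall>t>0. s + t = 1 \<longrightarrow>
       f (s *\<^sub>R x + t *\<^sub>R y) \<le> ereal s * f x + ereal t * f y)"

definition lower_semicontinuous :: "('a::topological_space \<Rightarrow> ereal) \<Rightarrow> bool"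
  where "lower_semicontinuous f \<longleftrightarrow> (\<forall>x. f x \<le> Liminf (at x) f)"

text \<open>For proper \<open>f\<close> the set below is empty at every point where \<open>f\<close> is infinite. On a product
  space the inner product is the sum of the componentwise ones.\<close>

definition subdifferential :: "('a::real_inner \<Rightarrow> ereal) \<Rightarrow> 'a \<Rightarrow> 'a set"
  where "subdifferential f x = {p. \<forall>y. f x + ereal (p \<bullet> (y - x)) \<le> f y}"

text \<open>\<open>u\<close> is of class \<open>C\<^sup>1\<close> on the compact interval \<open>[0,T]\<close> with derivative \<open>u'\<close>; the
  derivatives at the endpoints are one-sided.\<close>

definition C1_with_derivative :: "real \<Rightarrow> (real \<Rightarrow> 'a::real_normed_vector) \<Rightarrow> (real \<Rightarrow> 'a) \<Rightarrow> bool"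
  where "C1_with_derivative T u u' \<longleftrightarrow>
    (\<forall>t\<in>{0..T}. (u has_vector_derivative u' t) (at t within {0..T})) \<and> continuous_on {0..T} u'"

text \<open>In the boundary value problem \<open>g t\<close> stands for the gradient \<open>\<nabla>\<^sub>u F(t,\<cdot>)\<close>, and \<open>w\<close> is the
  derivative of \<open>\<phi>(u')\<close>.\<close>

definition bvp_solution ::
  "real \<Rightarrow> real \<Rightarrow> (real^'n \<Rightarrow> real^'n) \<Rightarrow> (real \<Rightarrow> real^'n \<Rightarrow> real^'n) \<Rightarrow>
   ((real^'n) \<times> (real^'n) \<Rightarrow> ereal) \<Rightarrow> (real \<Rightarrow> real^'n) \<Rightarrow> bool"
  where "bvp_solution T a \<phi> g j u \<longleftrightarrow>
    (\<exists>u' w. C1_with_derivative T u u' \<and>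
       (\<forall>t\<in>{0..T}. norm (u' t) < a) \<and>
       C1_with_derivative T (\<lambda>t. \<phi> (u' t)) w \<and>
       subdifferential j (u 0, u T) \<noteq> {} \<and>
       (\<forall>t\<in>{0..T}. - w t = g t (u t)) \<and>
       (\<phi> (u' 0), - \<phi> (u' T)) \<in> subdifferential j (u 0, u T))"

end

theory Submission
  imports Defs "HOL-Complex_Analysis.Great_Picard"
begin

text \<open>
  Convexity, lower semicontinuity and \<open>j = 0\<close> on the diagonal make \<open>j\<close>
  invariant under diagonal translations, so \<open>j (x, y) = J (y - x)\<close>. The solutions are
  then critical points of \<open>E u = \<integral> \<Phi> (u') + J (u T - u 0) - \<integral> F t
  (u t)\<close>. By coercivity \<open>E\<close> tends to minus infinity on the constant functions,
  while it is bounded below on the functions with \<open>u 0 = 0\<close>.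

  The critical point is produced without a flow. Linearising the \<open>F\<close>-term at
  \<open>u\<close>, with its mean force removed, leaves a convex minimisation problem whose
  minimiser \<open>v\<close> satisfies \<open>\<phi> (v') = q - H\<close> for an explicit load
  \<open>H\<close> and a multiplier \<open>q\<close> in \<open>\<real>\<^sup>N\<close> that
  depends continuously on \<open>H\<close>. Moving \<open>u\<close> a small step towards
  \<open>v\<close>, and its mean along the total force, is continuous in \<open>u\<close> and
  lowers \<open>E\<close> by nearly the step size times the gap \<open>\<integral> B +
  |\<integral> \<nabla>F|\<^sup>2\<close>, where \<open>B\<close> is the Bregman distance of
  \<open>\<Phi>\<close> from \<open>v'\<close> to \<open>u'\<close>. Since
  \<open>\<nabla>F\<close> is bounded, iterating from the constants \<open>\<xi>\<close> displaces
  \<open>u 0\<close> by a bounded amount, so by Brouwer some orbit of any prescribed length ends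
  with \<open>u 0 = 0\<close>. All its levels are bounded below, which makes the gap arbitrarily
  small along such orbits; the Arzela-Ascoli theorem yields the solution in the limit.
\<close>

section \<open>Zeros of vector fields and uniform limits\<close>

lemma zero_of_outward_field:
  fixes f :: "'a::euclidean_space \<Rightarrow> 'a"
  assumes R: "R > 0" and f: "continuous_on (cball 0 R) f"
    and out: "\<And>x. norm x = R \<Longrightarrow> f x \<bullet> x \<ge> 0"
  obtains x where "f x = 0"
proof -
  let ?g = "\<lambda>x. closest_point (cball 0 R) (x - f x)"
  have ne: "cball (0::'a) R \<noteq> {}" "\<not> R < 0" using R by simp_all
  have "continuous_on (cball 0 R) ?g"
    by (rule continuous_on_compose2[OF continuous_on_closest_point[of "cball 0 R" UNIV]])
       (use ne in \<open>auto intro!: continuous_intros f\<close>)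
  moreover have "?g \<in> cball 0 R \<rightarrow> cball 0 R"
    using closest_point_in_set[of "cball (0::'a) R"] ne by blast
  ultimately obtain x where x: "x \<in> cball 0 R" "?g x = x"
    using brouwer_ball[OF R] by blast
  have "f x \<bullet> (y - x) \<ge> 0" if "y \<in> cball 0 R" for y
    using closest_point_dot[of "cball 0 R" y "x - f x"] that x(2) by simp
  from this[of "- (R / norm (f x)) *\<^sub>R f x"] R
  have 1: "- R * norm (f x) \<ge> f x \<bullet> x" if "f x \<noteq> 0"
    using that by (simp add: inner_diff_right dot_square_norm power2_eq_square)
  have "f x = 0"
  proof (cases "norm x = R")
    case True
    then show ?thesis using 1 out[OF True] R
      by (metis mult_minus_left mult_pos_pos neg_0_le_iff_le norm_le_zero_iff not_le order_trans)
  next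
    case False
    then have "norm x < R" using x by simp
    then have "\<bar>f x \<bullet> x\<bar> \<le> norm (f x) * norm x" by (simp add: Cauchy_Schwarz_ineq2)
    moreover have "norm (f x) * norm x < norm (f x) * R" if "f x \<noteq> 0"
      using that \<open>norm x < R\<close> by simp
    ultimately show ?thesis using 1 by (smt (verit) mult.commute mult_minus_left)
  qed
  then show ?thesis by (rule that)
qed

lemma zero_of_bounded_displacement:
  fixes P :: "'a::euclidean_space \<Rightarrow> 'a"
  assumes P: "continuous_on UNIV P" and B: "\<And>x. norm (P x - x) \<le> B"
  obtains x where "P x = 0"
proof -
  have "continuous_on (cball 0 (max B 1)) (\<lambda>x. x - P x)"
    using P by (auto intro!: continuous_intros elim: continuous_on_subset)
  moreover have "(\<lambda>x. x - P x) \<in> cball 0 (max B 1) \<rightarrow> cball 0 (max B 1)"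
    using B by (auto simp: norm_minus_commute intro!: max.coboundedI1)
  ultimately obtain x where "x - P x = x"
    using brouwer_ball[of "max B 1" 0 "\<lambda>x. x - P x"] by (metis less_max_iff_disj zero_less_one)
  then show ?thesis using that[of x] by simp
qed

lemma uniform_limit_continuous_compose:
  fixes l :: "'b::metric_space \<Rightarrow> 'a::euclidean_space" and g :: "'b \<times> 'a \<Rightarrow> 'c::metric_space"
  assumes S: "compact (S :: 'b set)" and g: "continuous_on (S \<times> UNIV) g"
    and f: "uniform_limit S f l F" and l: "continuous_on S l"
  shows "uniform_limit S (\<lambda>k t. g (t, f k t)) (\<lambda>t. g (t, l t)) F"
proof -
  obtain B where B: "\<And>t. t \<in> S \<Longrightarrow> norm (l t) \<le> B"
    using compact_imp_bounded[OF compact_continuous_image[OF l S]]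
    by (auto simp: bounded_iff)
  let ?K = "S \<times> cball (0::'a) (B + 1)"
  have "compact ?K" using S by (intro compact_Times) auto
  moreover have "continuous_on ?K g" by (rule continuous_on_subset[OF g]) auto
  ultimately have uc: "uniformly_continuous_on ?K g" by (intro compact_uniformly_continuous)
  show ?thesis
  proof (rule uniform_limitI)
    fix e :: real assume "e > 0"
    then obtain d where d: "d > 0"
      "\<And>z z'. z \<in> ?K \<Longrightarrow> z' \<in> ?K \<Longrightarrow> dist z' z < d \<Longrightarrow> dist (g z') (g z) < e"
      using uc unfolding uniformly_continuous_on_def by blast
    have "\<forall>\<^sub>F k in F. \<forall>t\<in>S. dist (f k t) (l t) < min d 1"
      using uniform_limitD[OF f, of "min d 1"] d by auto
    then show "\<forall>\<^sub>F k in F. \<forall>t\<in>S. dist (g (t, f k t)) (g (t, l t)) < e"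
    proof (rule eventually_mono, safe)
      fix k t assume *: "\<forall>t\<in>S. dist (f k t) (l t) < min d 1" and t: "t \<in> S"
      have "norm (f k t) \<le> norm (l t) + dist (f k t) (l t)"
        by (metis dist_norm norm_triangle_sub)
      then have "norm (f k t) \<le> B + 1" using B[OF t] bspec[OF * t] by simp
      then show "dist (g (t, f k t)) (g (t, l t)) < e"
        using bspec[OF * t] B[OF t] t by (intro d(2)) (auto simp: dist_Pair_Pair)
    qed
  qed
qed

lemma uniform_limit_indefinite_integral:
  fixes f :: "'b \<Rightarrow> real \<Rightarrow> 'a::euclidean_space"
  assumes T: "0 \<le> T" and f: "\<And>k. continuous_on {0..T} (f k)" and l: "continuous_on {0..T} l"
    and lim: "uniform_limit {0..T} f l F"
  shows "uniform_limit {0..T} (\<lambda>k t. integral {0..t} (f k)) (\<lambda>t. integral {0..t} l) F"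
proof (rule uniform_limitI)
  fix e :: real assume e: "e > 0"
  let ?d = "e / (2 * (T + 1))"
  have de: "?d * (T + 1) = e / 2" using T by (simp add: divide_simps)
  have "?d > 0" using e T by simp
  from uniform_limitD[OF lim this]
  show "\<forall>\<^sub>F k in F. \<forall>t\<in>{0..T}. dist (integral {0..t} (f k)) (integral {0..t} l) < e"
  proof (rule eventually_mono, safe)
    fix k t assume *: "\<forall>t\<in>{0..T}. dist (f k t) (l t) < ?d" and t: "t \<in> {0..T}"
    have c: "continuous_on {0..t} (f k)" "continuous_on {0..t} l"
      using t by (auto intro: continuous_on_subset[OF f] continuous_on_subset[OF l])
    have "norm (integral {0..t} (\<lambda>s. f k s - l s)) \<le> ?d * (t - 0)"
      using t * by (intro integral_bound continuous_intros c) (auto simp: dist_norm intro: less_imp_le)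
    also have "\<dots> \<le> ?d * (T + 1)" using t e T by (intro mult_left_mono) auto
    also have "\<dots> < e" unfolding de using e by simp
    finally show "dist (integral {0..t} (f k)) (integral {0..t} l) < e"
      using c by (simp add: dist_norm integral_diff integrable_continuous_real)
  qed
qed

lemma inner_integral_left:
  fixes f :: "real \<Rightarrow> 'a::euclidean_space"
  assumes "f integrable_on S"
  shows "q \<bullet> integral S f = integral S (\<lambda>t. q \<bullet> f t)"
  using integral_linear[OF assms bounded_linear_inner_right[of q]] by (simp add: o_def)

section \<open>Convex lower semicontinuous boundary costs\<close>

locale lsc_convex_cost =
  fixes D :: "'a::euclidean_space set" and J :: "'a \<Rightarrow> real" and M :: real
  assumes closed_epigraph: "closed {(w, r). w \<in> D \<and> J w \<le> r}"
    and convex_J: "convex_on D J"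
    and zero_in_D: "0 \<in> D" and J_zero: "J 0 = 0"
    and J_nonneg: "\<And>w. w \<in> D \<Longrightarrow> 0 \<le> J w"
    and J_le: "\<And>w. w \<in> D \<Longrightarrow> J w \<le> M"
begin

definition subgrad :: "'a \<Rightarrow> 'a \<Rightarrow> bool"
  where "subgrad w p \<longleftrightarrow> w \<in> D \<and> (\<forall>v\<in>D. J v \<ge> J w + p \<bullet> (v - w))"

lemma convex_D: "convex D"
  using convex_J by (simp add: convex_on_def)

lemma subgrad_monotone: "subgrad w p \<Longrightarrow> subgrad v r \<Longrightarrow> (p - r) \<bullet> (w - v) \<ge> 0"
  unfolding subgrad_def
  by (smt (verit) inner_diff_left inner_diff_right)

lemma prox_exists: "\<exists>w. subgrad w (z - w)"
proof -
  let ?E = "{(w, r). w \<in> D \<and> J w \<le> r}"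
  let ?B = "(norm z)\<^sup>2 / 2"
  let ?K = "?E \<inter> (cball 0 (2 * norm z) \<times> {0..?B})"
  let ?f = "\<lambda>(w, r). r + (norm (w - z))\<^sup>2 / 2"
  have "compact ?K"
    by (intro closed_Int_compact closed_epigraph compact_Times) auto
  moreover have "(0, 0) \<in> ?K" by (auto simp: zero_in_D J_zero)
  moreover have "continuous_on ?K ?f"
    by (auto simp: case_prod_unfold intro!: continuous_intros)
  ultimately obtain wr where wr: "wr \<in> ?K" "\<And>v. v \<in> ?K \<Longrightarrow> ?f wr \<le> ?f v"
    by (metis (lifting) continuous_attains_inf empty_iff)
  obtain w r where wr': "wr = (w, r)" by force
  then have w: "w \<in> D" "J w \<le> r" using wr by auto
  have min: "J w + (norm (w - z))\<^sup>2 / 2 \<le> J v + (norm (v - z))\<^sup>2 / 2" if v: "v \<in> D" for v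
  proof (cases "(v, J v) \<in> ?K")
    case True
    then show ?thesis using wr(2)[OF True] w by (simp add: wr')
  next
    case False
    then have "norm v > 2 * norm z \<or> J v > ?B" using v J_nonneg[OF v] by auto
    moreover have "J w + (norm (w - z))\<^sup>2 / 2 \<le> ?B"
      using wr(2)[OF \<open>(0,0) \<in> ?K\<close>] w by (simp add: wr')
    moreover have "?B \<le> (norm (v - z))\<^sup>2 / 2" if "norm v > 2 * norm z"
    proof -
      have "norm z \<le> norm (v - z)" using that norm_triangle_ineq2[of v z] by simp
      then show ?thesis by (simp add: power_mono)
    qed
    ultimately show ?thesis using J_nonneg[OF v]
      by (smt (verit) divide_nonneg_nonneg zero_le_power2)
  qed
  have "J v \<ge> J w + (z - w) \<bullet> (v - w)" if v: "v \<in> D" for v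
  proof -
    have ineq: "0 \<le> (J v - J w - (z - w) \<bullet> (v - w)) + s / 2 * (norm (v - w))\<^sup>2"
      if s: "0 < s" "s < 1" for s :: real
    proof -
      define u where "u = (1 - s) *\<^sub>R w + s *\<^sub>R v"
      have "u \<in> D"
        using convexD[OF convex_D w(1) v, of "1 - s" s] s by (simp add: u_def)
      then have "J w + (norm (w - z))\<^sup>2 / 2 \<le> J u + (norm (u - z))\<^sup>2 / 2" by (rule min)
      moreover have "J u \<le> (1 - s) * J w + s * J v"
        using convex_onD[OF convex_J, of s w v] s w v by (simp add: u_def)
      then have "J u \<le> J w - s * J w + s * J v" by (simp add: left_diff_distrib)
      moreover have "u - z = (w - z) + s *\<^sub>R (v - w)"
        by (simp add: u_def algebra_simps)
      moreover have "(norm ((w - z) + s *\<^sub>R (v - w)))\<^sup>2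
          = (norm (w - z))\<^sup>2 + 2 * s * ((w - z) \<bullet> (v - w)) + s\<^sup>2 * (norm (v - w))\<^sup>2"
        by (simp only: power2_norm_eq_inner)
           (simp add: inner_add_left inner_add_right inner_commute[of "v - w" "w - z"]
            power2_eq_square distrib_left mult.assoc)
      ultimately have "0 \<le> - s * J w + s * J v
          + (2 * s * ((w - z) \<bullet> (v - w)) + s\<^sup>2 * (norm (v - w))\<^sup>2) / 2"
        by (simp add: add_divide_distrib)
      also have "\<dots> = s * ((J v - J w - (z - w) \<bullet> (v - w)) + s / 2 * (norm (v - w))\<^sup>2)"
        by (subst minus_diff_eq[of z w, symmetric], simp only: inner_minus_left)
           (simp add: field_simps power2_eq_square)
      finally show ?thesis using s by (simp add: zero_le_mult_iff)
    qed
    have "((\<lambda>s. (J v - J w - (z - w) \<bullet> (v - w)) + s / 2 * (norm (v - w))\<^sup>2)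
        \<longlongrightarrow> (J v - J w - (z - w) \<bullet> (v - w)) + 0 / 2 * (norm (v - w))\<^sup>2) (at_right 0)"
      by (intro tendsto_intros) auto
    moreover have "\<forall>\<^sub>F s in at_right (0::real).
        0 \<le> (J v - J w - (z - w) \<bullet> (v - w)) + s / 2 * (norm (v - w))\<^sup>2"
      unfolding eventually_at_right_field by (intro exI[of _ 1]) (auto intro!: ineq simp del: times_divide_eq_left)
    ultimately show ?thesis
      using tendsto_lowerbound[OF _ _ trivial_limit_at_right_real] by fastforce
  qed
  then show ?thesis using w unfolding subgrad_def by blast
qed

definition prox :: "'a \<Rightarrow> 'a"
  where "prox z = (SOME w. subgrad w (z - w))"

lemma prox: "subgrad (prox z) (z - prox z)"
  unfolding prox_def by (rule someI_ex[OF prox_exists])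

lemma prox_nonexpansive: "dist (prox z) (prox z') \<le> dist z z'"
proof -
  let ?d = "prox z - prox z'"
  have "0 \<le> ((z - prox z) - (z' - prox z')) \<bullet> ?d"
    by (rule subgrad_monotone[OF prox prox])
  then have "?d \<bullet> ?d \<le> (z - z') \<bullet> ?d"
    by (simp add: inner_diff_left)
  also have "\<dots> \<le> norm (z - z') * norm ?d" by (rule norm_cauchy_schwarz)
  finally have "norm ?d * norm ?d \<le> norm (z - z') * norm ?d"
    by (simp add: dot_square_norm power2_eq_square)
  then show ?thesis
    by (cases "?d = 0") (auto simp: dist_norm)
qed

lemma continuous_on_prox: "continuous_on S prox"
  unfolding continuous_on_iff using prox_nonexpansive by (meson le_less_trans)

end

section \<open>The singular homeomorphism\<close>

locale singular_homeomorphism =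
  fixes a :: real and \<phi> \<psi> :: "'a::euclidean_space \<Rightarrow> 'a" and \<Phi> :: "'a \<Rightarrow> real"
  assumes a_pos: "a > 0"
    and homeo: "homeomorphism (ball 0 a) UNIV \<phi> \<psi>"
    and \<Phi>_nonpos: "\<And>x. x \<in> cball 0 a \<Longrightarrow> \<Phi> x \<le> 0"
    and \<Phi>_gderiv: "\<And>x. x \<in> ball 0 a \<Longrightarrow> GDERIV \<Phi> x :> \<phi> x"
    and \<Phi>_cont: "continuous_on (cball 0 a) \<Phi>"
    and \<Phi>_convex: "strictly_convex_on (cball 0 a) \<Phi>"
begin

lemma \<psi>_ball: "norm (\<psi> p) < a"
  using homeomorphism_image2[OF homeo] by force

lemma \<phi>_\<psi>: "\<phi> (\<psi> p) = p"
  using homeomorphism_apply2[OF homeo] by simp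

lemma \<psi>_cont: "continuous_on S \<psi>"
  using homeomorphism_cont2[OF homeo] continuous_on_subset by blast

lemma \<psi>_continuous_compose: "continuous_on S f \<Longrightarrow> continuous_on S (\<lambda>t. \<psi> (f t))"
  by (rule continuous_on_compose2[OF \<psi>_cont[of UNIV]]) auto

definition bregman :: "'a \<Rightarrow> 'a \<Rightarrow> real"
  where "bregman x y = \<Phi> x - \<Phi> y - \<phi> y \<bullet> (x - y)"

lemma \<Phi>_convexD:
  assumes "norm x \<le> a" "norm y \<le> a" "0 \<le> s" "s \<le> 1"
  shows "\<Phi> (y + s *\<^sub>R (x - y)) \<le> \<Phi> y + s * (\<Phi> x - \<Phi> y)"
proof (cases "x = y \<or> s = 0 \<or> s = 1")
  case True
  then show ?thesis by auto
next
  case False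
  then have s: "0 < s" "0 < 1 - s" using assms by auto
  have "\<forall>x\<in>cball 0 a. \<forall>y\<in>cball 0 a. \<forall>s>0. \<forall>t>0. x \<noteq> y \<and> s + t = 1 \<longrightarrow>
       \<Phi> (s *\<^sub>R x + t *\<^sub>R y) < s * \<Phi> x + t * \<Phi> y"
    using \<Phi>_convex unfolding strictly_convex_on_def by blast
  then have "\<Phi> (s *\<^sub>R x + (1 - s) *\<^sub>R y) < s * \<Phi> x + (1 - s) * \<Phi> y"
    using s assms False by auto
  moreover have "s *\<^sub>R x + (1 - s) *\<^sub>R y = y + s *\<^sub>R (x - y)" by (simp add: algebra_simps)
  ultimately show ?thesis by (simp add: algebra_simps)
qed

lemma bregman_nonneg:
  assumes x: "norm x \<le> a" and y: "norm y < a"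
  shows "bregman x y \<ge> 0"
proof -
  have "(\<Phi> has_derivative (\<lambda>h. h \<bullet> \<phi> y)) (at (y + 0 *\<^sub>R (x - y)))"
    using \<Phi>_gderiv[of y] y by (simp add: gderiv_def)
  then have "((\<lambda>s. \<Phi> (y + s *\<^sub>R (x - y))) has_derivative (\<lambda>s. (s *\<^sub>R (x - y)) \<bullet> \<phi> y)) (at 0)"
    by (rule has_derivative_compose[rotated]) (auto intro!: derivative_eq_intros)
  then have "DERIV (\<lambda>s. \<Phi> (y + s *\<^sub>R (x - y))) 0 :> (x - y) \<bullet> \<phi> y"
    by (simp add: has_field_derivative_def mult_commute_abs)
  then have "((\<lambda>s. (\<Phi> (y + s *\<^sub>R (x - y)) - \<Phi> y) / s) \<longlongrightarrow> (x - y) \<bullet> \<phi> y) (at 0)"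
    by (simp add: DERIV_def)
  then have "((\<lambda>s. (\<Phi> (y + s *\<^sub>R (x - y)) - \<Phi> y) / s) \<longlongrightarrow> (x - y) \<bullet> \<phi> y) (at_right 0)"
    by (rule filterlim_mono) (simp_all add: at_le)
  moreover have "\<forall>\<^sub>F s in at_right 0. (\<Phi> (y + s *\<^sub>R (x - y)) - \<Phi> y) / s \<le> \<Phi> x - \<Phi> y"
    using eventually_at_right_real[of 0 1]
  proof (rule eventually_mono)
    fix s :: real assume "s \<in> {0<..<1}"
    then show "(\<Phi> (y + s *\<^sub>R (x - y)) - \<Phi> y) / s \<le> \<Phi> x - \<Phi> y"
      using \<Phi>_convexD[of x y s] x y by (simp add: pos_divide_le_eq mult.commute)
  qed simp
  ultimately have "(x - y) \<bullet> \<phi> y \<le> \<Phi> x - \<Phi> y"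
    by (rule tendsto_upperbound) simp
  then show ?thesis by (simp add: bregman_def inner_commute)
qed

lemma bregman_pos:
  assumes x: "norm x \<le> a" and y: "norm y < a" and ne: "x \<noteq> y"
  shows "bregman x y > 0"
proof -
  let ?m = "(1/2) *\<^sub>R x + (1/2) *\<^sub>R y"
  have "\<forall>x\<in>cball 0 a. \<forall>y\<in>cball 0 a. \<forall>s>0. \<forall>t>0. x \<noteq> y \<and> s + t = 1 \<longrightarrow>
       \<Phi> (s *\<^sub>R x + t *\<^sub>R y) < s * \<Phi> x + t * \<Phi> y"
    using \<Phi>_convex unfolding strictly_convex_on_def by blast
  from this[rule_format, of x y "1/2" "1/2"]
  have "\<Phi> ?m < (\<Phi> x + \<Phi> y) / 2" using x y ne by (simp add: add_divide_distrib)
  moreover have "norm ?m \<le> a"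
    using norm_triangle_ineq[of "(1/2) *\<^sub>R x" "(1/2) *\<^sub>R y"] x y by simp
  then have "bregman ?m y \<ge> 0" using y by (rule bregman_nonneg)
  moreover have "?m - y = (1/2) *\<^sub>R (x - y)"
    by (simp add: algebra_simps flip: scaleR_add_left)
  ultimately show ?thesis by (simp add: bregman_def)
qed

lemma \<psi>_strict_mono:
  assumes "p \<noteq> p'"
  shows "(p - p') \<bullet> (\<psi> p - \<psi> p') > 0"
proof -
  have "\<psi> p \<noteq> \<psi> p'" using assms \<phi>_\<psi> by metis
  then have "bregman (\<psi> p) (\<psi> p') + bregman (\<psi> p') (\<psi> p) > 0"
    using bregman_pos \<psi>_ball by (simp add: add_pos_pos less_imp_le)
  then show ?thesis by (simp add: bregman_def \<phi>_\<psi> inner_diff_left inner_diff_right)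
qed

definition \<Phi>min :: real
  where "\<Phi>min = Inf (\<Phi> ` cball 0 a)"

lemma \<Phi>min_le: "norm x \<le> a \<Longrightarrow> \<Phi>min \<le> \<Phi> x"
  unfolding \<Phi>min_def
  using compact_imp_bounded[OF compact_continuous_image[OF \<Phi>_cont compact_cball]]
  by (intro cInf_lower bounded_imp_bdd_below) auto

lemma \<Phi>min_nonpos: "\<Phi>min \<le> 0"
  using \<Phi>min_le[of 0] \<Phi>_nonpos[of 0] a_pos by simp

lemma inner_\<psi>_ge: "p \<bullet> \<psi> p \<ge> a * norm p + \<Phi>min"
proof (cases "p = 0")
  case True
  then show ?thesis using \<Phi>min_nonpos by simp
next
  case False
  let ?x = "(a / norm p) *\<^sub>R p"
  have x: "norm ?x \<le> a" using False a_pos by simp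
  have "bregman ?x (\<psi> p) \<ge> 0" using x \<psi>_ball by (rule bregman_nonneg)
  moreover have "\<Phi> ?x \<le> 0" using x by (intro \<Phi>_nonpos) auto
  moreover have "\<Phi>min \<le> \<Phi> (\<psi> p)" using \<psi>_ball[of p] by (intro \<Phi>min_le) simp
  moreover have "p \<bullet> ?x = a * norm p"
    using False by (simp add: dot_square_norm power2_eq_square)
  ultimately show ?thesis
    unfolding bregman_def \<phi>_\<psi> inner_diff_right by linarith
qed

lemma inner_\<psi>_shift_ge:
  assumes "norm h \<le> B"
  shows "q \<bullet> \<psi> (q - h) \<ge> a * norm q - (2 * a * B - \<Phi>min)"
proof -
  have "(q - h) \<bullet> \<psi> (q - h) \<ge> a * norm (q - h) + \<Phi>min" by (rule inner_\<psi>_ge)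
  moreover have "a * norm (q - h) \<ge> a * (norm q - B)"
    using a_pos assms norm_triangle_ineq2[of q h] by (intro mult_left_mono) auto
  moreover have "\<bar>h \<bullet> \<psi> (q - h)\<bar> \<le> norm h * norm (\<psi> (q - h))" by (rule Cauchy_Schwarz_ineq2)
  moreover have "norm h * norm (\<psi> (q - h)) \<le> B * a"
    using assms \<psi>_ball[of "q - h"] by (intro mult_mono) (auto intro: order_trans[OF norm_ge_zero])
  ultimately show ?thesis by (simp add: inner_diff_left algebra_simps abs_le_iff)
qed

lemma dist_le_bregman:
  assumes e: "e > 0"
  obtains C where "C \<ge> 0" "\<And>x p. norm x \<le> a \<Longrightarrow> norm p \<le> B \<Longrightarrow>
    norm (x - \<psi> p) \<le> e + C * bregman x (\<psi> p)"
proof -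
  let ?K = "(cball 0 a \<times> cball 0 B) \<inter> {(x, p). norm (x - \<psi> p) \<ge> e}"
  have c\<psi>: "continuous_on UNIV (\<lambda>z::'a\<times>'a. \<psi> (snd z))"
    by (intro \<psi>_continuous_compose continuous_intros)
  have "closed {z::'a\<times>'a. e \<le> norm (fst z - \<psi> (snd z))}"
    by (intro closed_Collect_le continuous_intros c\<psi>)
  then have "closed {(x::'a, p). norm (x - \<psi> p) \<ge> e}" by (simp add: case_prod_unfold)
  then have K: "compact ?K"
    by (rule compact_Int_closed[OF compact_Times[OF compact_cball compact_cball]])
  have "continuous_on ?K (\<lambda>z. bregman (fst z) (\<psi> (snd z)))"
  proof -
    have c: "continuous_on ?K (\<lambda>z. \<psi> (snd z))" using c\<psi> continuous_on_subset by blast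
    have "continuous_on ?K (\<lambda>z. \<Phi> (fst z))"
      by (rule continuous_on_compose2[OF \<Phi>_cont]) (auto intro!: continuous_intros)
    moreover have "continuous_on ?K (\<lambda>z. \<Phi> (\<psi> (snd z)))"
      by (rule continuous_on_compose2[OF \<Phi>_cont c]) (use \<psi>_ball in \<open>auto simp: less_imp_le\<close>)
    ultimately show ?thesis
      unfolding bregman_def \<phi>_\<psi> by (intro continuous_intros c)
  qed
  then obtain m where m: "m > 0" "\<And>x p. (x, p) \<in> ?K \<Longrightarrow> bregman x (\<psi> p) \<ge> m"
  proof (cases "?K = {}")
    case True
    then show ?thesis using that[of 1] by fastforce
  next
    case False
    assume c: "continuous_on ?K (\<lambda>z. bregman (fst z) (\<psi> (snd z)))"
    from continuous_attains_inf[OF K False c]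
    obtain z where z: "z \<in> ?K" "\<And>z'. z' \<in> ?K \<Longrightarrow> bregman (fst z) (\<psi> (snd z)) \<le> bregman (fst z') (\<psi> (snd z'))"
      by blast
    have "bregman (fst z) (\<psi> (snd z)) > 0"
      using z(1) e \<psi>_ball by (intro bregman_pos) auto
    then show ?thesis using that z(2) by fastforce
  qed
  have "norm (x - \<psi> p) \<le> e + (2 * a / m) * bregman x (\<psi> p)" if x: "norm x \<le> a" and p: "norm p \<le> B" for x p
  proof (cases "norm (x - \<psi> p) \<ge> e")
    case True
    then have "m \<le> bregman x (\<psi> p)" using x p by (intro m(2)) auto
    then have "2 * a \<le> (2 * a / m) * bregman x (\<psi> p)"
      using m(1) a_pos by (simp add: field_simps)
    moreover have "norm (x - \<psi> p) \<le> 2 * a"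
      using norm_triangle_ineq4[of x "\<psi> p"] x \<psi>_ball[of p] by linarith
    ultimately show ?thesis using e by linarith
  next
    case False
    have "(2 * a / m) * bregman x (\<psi> p) \<ge> 0"
      using bregman_nonneg[OF x \<psi>_ball[of p]] m(1) a_pos by (intro mult_nonneg_nonneg) auto
    then show ?thesis using False by linarith
  qed
  then show ?thesis using that[of "2 * a / m"] m(1) a_pos by auto
qed

lemma \<psi>_mono_modulus:
  assumes e: "e > 0"
  obtains c where "c > 0" "\<And>p p'. norm p \<le> B \<Longrightarrow> norm p' \<le> B \<Longrightarrow> norm (p - p') \<ge> e \<Longrightarrow>
    (p - p') \<bullet> (\<psi> p - \<psi> p') \<ge> c"
proof -
  let ?K = "(cball (0::'a) B \<times> cball (0::'a) B) \<inter> {z. norm (fst z - snd z) \<ge> e}"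
  let ?f = "\<lambda>z. (fst z - snd z) \<bullet> (\<psi> (fst z) - \<psi> (snd z))"
  have "closed {z::'a\<times>'a. e \<le> norm (fst z - snd z)}"
    by (intro closed_Collect_le continuous_intros)
  then have K: "compact ?K"
    by (rule compact_Int_closed[OF compact_Times[OF compact_cball compact_cball]])
  have c: "continuous_on ?K ?f" by (intro continuous_intros \<psi>_continuous_compose)
  show ?thesis
  proof (cases "?K = {}")
    case True
    then show ?thesis using that[of 1] by fastforce
  next
    case False
    from continuous_attains_inf[OF K False c]
    obtain z where z: "z \<in> ?K" "\<And>z'. z' \<in> ?K \<Longrightarrow> ?f z \<le> ?f z'" by blast
    have "?f z > 0" using z(1) e by (intro \<psi>_strict_mono) auto
    then show ?thesis using that[of "?f z"] z(2) by fastforce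
  qed
qed

end

section \<open>The multiplier of a load\<close>

locale boundary_problem =
  singular_homeomorphism a \<phi> \<psi> \<Phi> + lsc_convex_cost D J M
  for a :: real and \<phi> \<psi> :: "'a::euclidean_space \<Rightarrow> 'a" and \<Phi> :: "'a \<Rightarrow> real"
    and D :: "'a set" and J :: "'a \<Rightarrow> real" and M :: real +
  fixes T :: real
  assumes T_pos: "T > 0"
begin

definition displacement :: "(real \<Rightarrow> 'a) \<Rightarrow> 'a \<Rightarrow> 'a"
  where "displacement H q = integral {0..T} (\<lambda>t. \<psi> (q - H t))"

definition multiplier :: "(real \<Rightarrow> 'a) \<Rightarrow> 'a"
  where "multiplier H = (SOME q. subgrad (displacement H q) (- q))"

lemma \<psi>_load_cont: "continuous_on {0..T} H \<Longrightarrow> continuous_on {0..T} (\<lambda>t. \<psi> (q - H t))"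
  by (intro \<psi>_continuous_compose continuous_intros)

lemma integrable_\<psi>_load: "continuous_on {0..T} H \<Longrightarrow> (\<lambda>t. \<psi> (q - H t)) integrable_on {0..T}"
  by (intro integrable_continuous_real \<psi>_load_cont)

lemma norm_displacement_le:
  assumes "continuous_on {0..T} H"
  shows "norm (displacement H q) \<le> a * T"
  using integral_bound[OF less_imp_le[OF T_pos] \<psi>_load_cont[OF assms], where B = a]
  by (simp add: displacement_def \<psi>_ball less_imp_le)

lemma displacement_diff:
  assumes H: "continuous_on {0..T} H" and H': "continuous_on {0..T} H'"
  shows "p \<bullet> (displacement H q - displacement H' q')
    = integral {0..T} (\<lambda>t. p \<bullet> (\<psi> (q - H t) - \<psi> (q' - H' t)))"
  unfolding displacement_def integral_diff[OF integrable_\<psi>_load[OF H] integrable_\<psi>_load[OF H'], symmetric]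
  by (intro inner_integral_left integrable_diff integrable_\<psi>_load H H')

lemma inner_displacement_ge:
  assumes H: "continuous_on {0..T} H" and B: "\<And>t. t \<in> {0..T} \<Longrightarrow> norm (H t) \<le> B"
  shows "q \<bullet> displacement H q \<ge> T * (a * norm q - (2 * a * B - \<Phi>min))"
proof -
  have "integral {0..T} (\<lambda>t. a * norm q - (2 * a * B - \<Phi>min))
      \<le> integral {0..T} (\<lambda>t. q \<bullet> \<psi> (q - H t))"
    by (intro integral_le integrable_continuous_real continuous_intros \<psi>_load_cont[OF H]
        inner_\<psi>_shift_ge B)
  then show ?thesis
    using T_pos by (simp add: displacement_def inner_integral_left integrable_\<psi>_load[OF H])
qed

lemma tendsto_displacement:
  assumes H: "continuous_on {0..T} H" and Hk: "\<And>k. continuous_on {0..T} (Hk k)"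
    and lim: "uniform_limit {0..T} Hk H F"
  shows "((\<lambda>k. displacement (Hk k) q) \<longlongrightarrow> displacement H q) F"
proof -
  have c: "continuous_on ({0..T} \<times> UNIV) (\<lambda>z. \<psi> (q - snd z))"
    by (intro \<psi>_continuous_compose continuous_intros)
  have "uniform_limit {0..T} (\<lambda>k t. \<psi> (q - Hk k t)) (\<lambda>t. \<psi> (q - H t)) F"
    using uniform_limit_continuous_compose[OF _ c lim H] by simp
  from uniform_limit_indefinite_integral[OF _ \<psi>_load_cont[OF Hk] \<psi>_load_cont[OF H] this]
  have "uniform_limit {0..T} (\<lambda>k t. integral {0..t} (\<lambda>t. \<psi> (q - Hk k t)))
      (\<lambda>t. integral {0..t} (\<lambda>t. \<psi> (q - H t))) F"
    using T_pos by simp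
  then show ?thesis unfolding displacement_def
    using T_pos by (intro tendsto_uniform_limitI[where x = T]) auto
qed

lemma displacement_cont:
  assumes H: "continuous_on {0..T} H"
  shows "continuous_on UNIV (displacement H)"
  unfolding continuous_on_def
proof
  fix q
  have "((\<lambda>q'. displacement (\<lambda>t. H t - q') 0) \<longlongrightarrow> displacement (\<lambda>t. H t - q) 0) (at q within UNIV)"
  proof (rule tendsto_displacement)
    show "uniform_limit {0..T} (\<lambda>q' t. H t - q') (\<lambda>t. H t - q) (at q within UNIV)"
    proof (rule uniform_limitI)
      fix e :: real assume "e > 0"
      then have "\<forall>\<^sub>F q' in at q. dist q' q < e" by (auto simp: eventually_at)
      then show "\<forall>\<^sub>F q' in at q. \<forall>t\<in>{0..T}. dist (H t - q') (H t - q) < e"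
        by (rule eventually_mono) (auto simp: dist_norm norm_minus_commute)
    qed
  qed (intro continuous_intros H)+
  then show "(displacement H \<longlongrightarrow> displacement H q) (at q within UNIV)"
    by (simp add: displacement_def[abs_def])
qed

text \<open>Writing \<open>w = prox z\<close> and \<open>q = w - z\<close> turns the inclusion into the equation
  \<open>prox z = displacement H (prox z - z)\<close>, whose defect points outwards on large spheres.\<close>

lemma multiplier_exists:
  assumes H: "continuous_on {0..T} H"
  shows "\<exists>q. subgrad (displacement H q) (- q)"
proof -
  obtain B where B: "\<And>t. t \<in> {0..T} \<Longrightarrow> norm (H t) \<le> B"
    using compact_imp_bounded[OF compact_continuous_image[OF H compact_Icc]]
    unfolding bounded_iff by blast
  let ?A = "\<lambda>z. z - prox z"
  let ?g = "\<lambda>z. prox z - displacement H (- ?A z)"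
  let ?K = "2 * a * B - \<Phi>min"
  define R where "R = max 1 (a * T + ?K / a)"
  have aT: "a * T > 0" using a_pos T_pos by simp
  have "continuous_on (cball 0 R) ?g"
    by (intro continuous_intros continuous_on_prox continuous_on_compose2[OF displacement_cont[OF H]]) auto
  moreover have "?g z \<bullet> z \<ge> 0" if z: "norm z = R" for z
  proof -
    let ?p = "prox z" and ?G = "displacement H (- ?A z)"
    have "0 \<le> ?A z \<bullet> ?p"
      using prox[of z] J_nonneg[of ?p] zero_in_D J_zero unfolding subgrad_def
      by (smt (verit) inner_minus_right diff_0)
    moreover have "(- ?A z) \<bullet> ?G \<ge> T * (a * norm (- ?A z) - ?K)"
      by (rule inner_displacement_ge[OF H B])
    moreover have "?p \<bullet> ?G \<le> norm ?p * (a * T)"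
      by (rule order_trans[OF norm_cauchy_schwarz])
         (intro mult_left_mono norm_displacement_le H norm_ge_zero)
    moreover have "?g z \<bullet> z = ?A z \<bullet> ?p + (- ?A z) \<bullet> ?G + ?p \<bullet> ?p - ?p \<bullet> ?G"
      by (simp add: inner_diff_left inner_diff_right inner_commute)
    moreover have "?p \<bullet> ?p - norm ?p * (a * T) \<ge> (a * T) * norm ?p - (a * T)\<^sup>2"
      using zero_le_power2[of "norm ?p - a * T"]
      by (simp add: dot_square_norm power2_diff algebra_simps)
    moreover have "norm (?A z) + norm ?p \<ge> R"
      using norm_triangle_ineq[of "?A z" ?p] z by simp
    then have "(a * T) * (norm (?A z) + norm ?p) \<ge> (a * T) * (a * T + ?K / a)"
      using aT by (intro mult_left_mono) (auto simp: R_def)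
    then have "(a * T) * norm (?A z) + (a * T) * norm ?p \<ge> (a * T)\<^sup>2 + T * ?K"
      using a_pos by (simp add: distrib_left power2_eq_square)
    ultimately show ?thesis by (simp add: norm_minus_commute algebra_simps)
  qed
  ultimately obtain z where "?g z = 0"
    using zero_of_outward_field[of R ?g] unfolding R_def by (metis less_max_iff_disj zero_less_one)
  then show ?thesis using prox[of z]
    by (intro exI[of _ "- ?A z"]) simp
qed

lemma multiplier:
  assumes "continuous_on {0..T} H"
  shows "subgrad (displacement H (multiplier H)) (- multiplier H)"
  unfolding multiplier_def by (rule someI_ex[OF multiplier_exists[OF assms]])

lemma norm_multiplier_le:
  assumes H: "continuous_on {0..T} H" and B: "\<And>t. t \<in> {0..T} \<Longrightarrow> norm (H t) \<le> B"
  shows "norm (multiplier H) \<le> (2 * a * B - \<Phi>min) / a"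
proof -
  let ?q = "multiplier H"
  have "?q \<bullet> displacement H ?q \<le> 0"
    using multiplier[OF H] J_nonneg[of "displacement H ?q"] zero_in_D J_zero unfolding subgrad_def
    by (smt (verit) inner_minus_right inner_minus_left diff_0)
  with inner_displacement_ge[OF H B, where q = ?q]
  have "T * (a * norm ?q - (2 * a * B - \<Phi>min)) \<le> 0" by linarith
  then have "a * norm ?q \<le> 2 * a * B - \<Phi>min" using T_pos by (simp add: mult_le_0_iff)
  then show ?thesis using a_pos by (simp add: field_simps)
qed

lemma tendsto_multiplier:
  assumes H: "continuous_on {0..T} H" and Hk: "\<And>k. continuous_on {0..T} (Hk k)"
    and lim: "uniform_limit {0..T} Hk H F"
  shows "((\<lambda>k. multiplier (Hk k)) \<longlongrightarrow> multiplier H) F"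
proof (rule tendstoI)
  fix e :: real assume e: "e > 0"
  obtain B where B: "\<And>t. t \<in> {0..T} \<Longrightarrow> norm (H t) \<le> B"
    using compact_imp_bounded[OF compact_continuous_image[OF H compact_Icc]]
    unfolding bounded_iff by blast
  let ?q = "multiplier H"
  define Q where "Q = (2 * a * (B + 1) - \<Phi>min) / a"
  have B0: "B \<ge> 0" using B[of 0] T_pos by (auto intro: order_trans[OF norm_ge_zero])
  have "2 * a * (B + 1) \<ge> 0" using B0 a_pos by simp
  then have Q0: "Q \<ge> 0" using a_pos \<Phi>min_nonpos unfolding Q_def by (intro divide_nonneg_nonneg) linarith+
  obtain c where c: "c > 0" "\<And>p p'. norm p \<le> Q + (B + 1) \<Longrightarrow> norm p' \<le> Q + (B + 1) \<Longrightarrow>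
      norm (p - p') \<ge> e \<Longrightarrow> (p - p') \<bullet> (\<psi> p - \<psi> p') \<ge> c"
    using \<psi>_mono_modulus[OF e] by blast
  let ?d = "T * c / (2 * (Q + 1))"
  have d: "?d > 0" using T_pos c Q0 by (intro divide_pos_pos mult_pos_pos) auto
  have "\<forall>\<^sub>F k in F. dist (displacement (Hk k) ?q) (displacement H ?q) < ?d"
    using tendstoD[OF tendsto_displacement[OF H Hk lim] d] .
  moreover have "\<forall>\<^sub>F k in F. \<forall>t\<in>{0..T}. dist (Hk k t) (H t) < 1"
    using uniform_limitD[OF lim, of 1] by simp
  ultimately show "\<forall>\<^sub>F k in F. dist (multiplier (Hk k)) ?q < e"
  proof eventually_elim
    case (elim k)
    let ?r = "multiplier (Hk k)"
    have Bk: "norm (Hk k t) \<le> B + 1" if "t \<in> {0..T}" for t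
      using bspec[OF elim(2) that] B[OF that] norm_triangle_sub[of "Hk k t" "H t"]
      by (simp add: dist_norm)
    have q: "norm ?q \<le> Q" unfolding Q_def using norm_multiplier_le[OF H, of "B + 1"] B by force
    have r: "norm ?r \<le> Q" unfolding Q_def using norm_multiplier_le[OF Hk Bk] .
    show ?case
    proof (rule ccontr)
      assume "\<not> dist ?r ?q < e"
      then have far: "norm (?r - ?q) \<ge> e" by (simp add: dist_norm)
      have "(- ?r - - ?q) \<bullet> (displacement (Hk k) ?r - displacement H ?q) \<ge> 0"
        by (rule subgrad_monotone[OF multiplier[OF Hk] multiplier[OF H]])
      then have "(?r - ?q) \<bullet> (displacement (Hk k) ?r - displacement (Hk k) ?q)
          \<le> (?r - ?q) \<bullet> (displacement H ?q - displacement (Hk k) ?q)"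
        by (simp add: inner_diff_left inner_diff_right)
      also have "\<dots> \<le> norm (?r - ?q) * norm (displacement H ?q - displacement (Hk k) ?q)"
        by (rule norm_cauchy_schwarz)
      also have "\<dots> \<le> (2 * Q) * norm (displacement H ?q - displacement (Hk k) ?q)"
        using norm_triangle_ineq4[of ?r ?q] q r by (intro mult_right_mono) auto
      also have "\<dots> \<le> (2 * Q) * ?d"
        using elim(1) Q0 by (intro mult_left_mono) (auto simp: dist_norm norm_minus_commute)
      also have "\<dots> < 2 * (Q + 1) * ?d"
        using d by (intro mult_strict_right_mono) auto
      also have "\<dots> = T * c" using Q0
        by (simp only: times_divide_eq_right) (rule nonzero_mult_div_cancel_left, simp)
      also have "T * c = integral {0..T} (\<lambda>t. c)" using T_pos by simp
      also have "\<dots> \<le> integral {0..T} (\<lambda>t. (?r - ?q) \<bullet> (\<psi> (?r - Hk k t) - \<psi> (?q - Hk k t)))"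
      proof (intro integral_le integrable_continuous_real continuous_intros \<psi>_load_cont Hk)
        fix t assume t: "t \<in> {0..T}"
        have "norm (?r - Hk k t) \<le> Q + (B + 1)" "norm (?q - Hk k t) \<le> Q + (B + 1)"
          using norm_triangle_ineq4[of ?r "Hk k t"] norm_triangle_ineq4[of ?q "Hk k t"] q r Bk[OF t]
          by linarith+
        from c(2)[OF this] far
        show "c \<le> (?r - ?q) \<bullet> (\<psi> (?r - Hk k t) - \<psi> (?q - Hk k t))" by simp
      qed
      also have "\<dots> = (?r - ?q) \<bullet> (displacement (Hk k) ?r - displacement (Hk k) ?q)"
        by (rule displacement_diff[symmetric]) (rule Hk)+
      finally show False by simp
    qed
  qed
qed

end

section \<open>Descent of the energy\<close>

locale forced_boundary_problem =
  boundary_problem a \<phi> \<psi> \<Phi> D J M T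
  for a :: real and \<phi> \<psi> :: "'a::euclidean_space \<Rightarrow> 'a" and \<Phi> :: "'a \<Rightarrow> real"
    and D :: "'a set" and J :: "'a \<Rightarrow> real" and M T :: real +
  fixes F :: "real \<Rightarrow> 'a \<Rightarrow> real" and gradF :: "real \<Rightarrow> 'a \<Rightarrow> 'a" and C :: real
  assumes F_cont: "continuous_on ({0..T} \<times> UNIV) (\<lambda>(t, x). F t x)"
    and F_gderiv: "\<And>t x. t \<in> {0..T} \<Longrightarrow> GDERIV (F t) x :> gradF t x"
    and gradF_cont: "continuous_on ({0..T} \<times> UNIV) (\<lambda>(t, x). gradF t x)"
    and F_zero: "\<And>t. t \<in> {0..T} \<Longrightarrow> F t 0 = 0"
    and gradF_bound: "\<And>t x. t \<in> {0..T} \<Longrightarrow> norm (gradF t x) \<le> C"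
    and F_coercive: "filterlim (\<lambda>x. integral {0..T} (\<lambda>t. F t x)) at_top at_infinity"
begin

definition traj :: "'a \<Rightarrow> (real \<Rightarrow> 'a) \<Rightarrow> real \<Rightarrow> 'a"
  where "traj x y t = x + integral {0..t} y"

definition force :: "'a \<Rightarrow> (real \<Rightarrow> 'a) \<Rightarrow> real \<Rightarrow> 'a"
  where "force x y t = gradF t (traj x y t)"

definition total_force :: "'a \<Rightarrow> (real \<Rightarrow> 'a) \<Rightarrow> 'a"
  where "total_force x y = integral {0..T} (force x y)"

definition load :: "'a \<Rightarrow> (real \<Rightarrow> 'a) \<Rightarrow> real \<Rightarrow> 'a"
  where "load x y t = integral {0..t} (force x y) - (t / T) *\<^sub>R total_force x y"

definition target :: "'a \<Rightarrow> (real \<Rightarrow> 'a) \<Rightarrow> real \<Rightarrow> 'a"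
  where "target x y t = \<psi> (multiplier (load x y) - load x y t)"

text \<open>The subtracted mean makes the velocity of the trajectory along the step have mean value
  \<open>total_force x y\<close>.\<close>

definition drift :: "'a \<Rightarrow> (real \<Rightarrow> 'a) \<Rightarrow> 'a"
  where "drift x y = total_force x y
    - (1 / T) *\<^sub>R integral {0..T} (\<lambda>t. integral {0..t} (\<lambda>r. target x y r - y r))"

definition direction :: "'a \<Rightarrow> (real \<Rightarrow> 'a) \<Rightarrow> real \<Rightarrow> 'a"
  where "direction x y t = drift x y + integral {0..t} (\<lambda>r. target x y r - y r)"

definition velocity_step :: "real \<Rightarrow> 'a \<Rightarrow> (real \<Rightarrow> 'a) \<Rightarrow> real \<Rightarrow> 'a"
  where "velocity_step s x y t = y t + s *\<^sub>R (target x y t - y t)"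

definition admissible :: "(real \<Rightarrow> 'a) \<Rightarrow> bool"
  where "admissible y \<longleftrightarrow>
    continuous_on {0..T} y \<and> (\<forall>t\<in>{0..T}. norm (y t) \<le> a) \<and> integral {0..T} y \<in> D"

definition energy :: "'a \<Rightarrow> (real \<Rightarrow> 'a) \<Rightarrow> real"
  where "energy x y = integral {0..T} (\<lambda>t. \<Phi> (y t)) + J (integral {0..T} y)
    - integral {0..T} (\<lambda>t. F t (traj x y t))"

definition gap :: "'a \<Rightarrow> (real \<Rightarrow> 'a) \<Rightarrow> real"
  where "gap x y = integral {0..T} (\<lambda>t. bregman (y t) (target x y t)) + (norm (total_force x y))\<^sup>2"

lemma T_nonneg: "0 \<le> T" using T_pos by simp

lemma C_nonneg: "0 \<le> C"
  using gradF_bound[of 0 0] T_pos by (auto intro: order_trans[OF norm_ge_zero])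

lemma traj_cont: "continuous_on {0..T} y \<Longrightarrow> continuous_on {0..T} (traj x y)"
  unfolding traj_def[abs_def]
  by (intro continuous_intros indefinite_integral_continuous_1 integrable_continuous_real)

lemma gradF_cont_compose:
  "continuous_on {0..T} u \<Longrightarrow> continuous_on {0..T} (\<lambda>t. gradF t (u t))"
  using continuous_on_compose2[OF gradF_cont continuous_on_Pair[OF continuous_on_id, of "{0..T}" u]] by auto

lemma F_cont_compose: "continuous_on {0..T} u \<Longrightarrow> continuous_on {0..T} (\<lambda>t. F t (u t))"
  using continuous_on_compose2[OF F_cont continuous_on_Pair[OF continuous_on_id, of "{0..T}" u]] by auto

lemma force_cont: "continuous_on {0..T} y \<Longrightarrow> continuous_on {0..T} (force x y)"
  unfolding force_def[abs_def] by (intro gradF_cont_compose traj_cont)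

lemma load_has_derivative:
  assumes "continuous_on {0..T} y" "t \<in> {0..T}"
  shows "(load x y has_vector_derivative (force x y t - (1 / T) *\<^sub>R total_force x y)) (at t within {0..T})"
  unfolding load_def[abs_def]
  using T_pos by (auto intro!: derivative_eq_intros integral_has_vector_derivative force_cont assms)

lemma load_cont: "continuous_on {0..T} y \<Longrightarrow> continuous_on {0..T} (load x y)"
  by (rule continuous_on_vector_derivative) (rule load_has_derivative)

lemma load_0 [simp]: "load x y 0 = 0"
  by (simp add: load_def)

lemma load_T [simp]: "load x y T = 0"
  using T_pos by (simp add: load_def total_force_def)

lemma norm_force_le: "t \<in> {0..T} \<Longrightarrow> norm (force x y t) \<le> C"
  unfolding force_def by (rule gradF_bound)

lemma norm_integral_le:
  fixes f :: "real \<Rightarrow> 'a"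
  assumes "continuous_on {0..T} f" "\<And>t. t \<in> {0..T} \<Longrightarrow> norm (f t) \<le> B" "t \<in> {0..T}"
  shows "norm (integral {0..t} f) \<le> B * T"
proof -
  have "B \<ge> 0" using assms(2)[of 0] T_pos by (auto intro: order_trans[OF norm_ge_zero])
  have "norm (integral {0..t} f) \<le> B * (t - 0)"
    using assms by (intro integral_bound continuous_on_subset[OF assms(1)]) auto
  also have "\<dots> \<le> B * T" using assms(3) \<open>B \<ge> 0\<close> by (intro mult_left_mono) auto
  finally show ?thesis .
qed

lemma norm_total_force_le: "continuous_on {0..T} y \<Longrightarrow> norm (total_force x y) \<le> C * T"
  unfolding total_force_def using T_nonneg
  by (intro norm_integral_le force_cont norm_force_le) auto

lemma norm_load_le:
  assumes y: "continuous_on {0..T} y" and t: "t \<in> {0..T}"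
  shows "norm (load x y t) \<le> 2 * C * T"
proof -
  have "norm (integral {0..t} (force x y)) \<le> C * T"
    by (intro norm_integral_le force_cont norm_force_le y t)
  moreover have "norm ((t / T) *\<^sub>R total_force x y) \<le> 1 * (C * T)"
    unfolding norm_scaleR using t T_pos norm_total_force_le[OF y] by (intro mult_mono) auto
  ultimately show ?thesis unfolding load_def
    using norm_triangle_ineq4[of "integral {0..t} (force x y)" "(t / T) *\<^sub>R total_force x y"] by linarith
qed

lemma target_cont: "continuous_on {0..T} y \<Longrightarrow> continuous_on {0..T} (target x y)"
  unfolding target_def[abs_def] by (intro \<psi>_load_cont load_cont)

lemma norm_target_less: "norm (target x y t) < a"
  unfolding target_def by (rule \<psi>_ball)

lemma \<phi>_target: "\<phi> (target x y t) = multiplier (load x y) - load x y t"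
  unfolding target_def by (rule \<phi>_\<psi>)

lemma target_subgrad:
  "continuous_on {0..T} y \<Longrightarrow> subgrad (integral {0..T} (target x y)) (- multiplier (load x y))"
  using multiplier[OF load_cont] unfolding displacement_def target_def[abs_def] .

lemma norm_target_diff_le:
  assumes "norm (y t) \<le> a" shows "norm (target x y t - y t) \<le> 2 * a"
  using norm_triangle_ineq4[of "target x y t" "y t"] norm_target_less[of x y t] assms by linarith

lemma norm_drift_le:
  assumes y: "admissible y"
  shows "norm (drift x y) \<le> C * T + 2 * a * T"
proof -
  note yc = y[unfolded admissible_def, THEN conjunct1]
  let ?e = "\<lambda>t. integral {0..t} (\<lambda>r. target x y r - y r)"
  have 1: "norm (?e t) \<le> 2 * a * T" if "t \<in> {0..T}" for t
    by (intro norm_integral_le that continuous_intros target_cont yc norm_target_diff_le)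
       (use y in \<open>auto simp: admissible_def\<close>)
  have "continuous_on {0..T} ?e"
    by (intro indefinite_integral_continuous_1 integrable_continuous_real continuous_intros target_cont yc)
  then have "norm (integral {0..T} ?e) \<le> 2 * a * T * T"
    using T_nonneg by (intro norm_integral_le 1) auto
  then have "norm ((1 / T) *\<^sub>R integral {0..T} ?e) \<le> 2 * a * T"
    using T_pos by (simp add: field_simps)
  then show ?thesis unfolding drift_def
    using norm_triangle_ineq4[of "total_force x y" "(1 / T) *\<^sub>R integral {0..T} ?e"]
      norm_total_force_le[OF yc, of x] by linarith
qed

lemma norm_direction_le:
  assumes y: "admissible y" and t: "t \<in> {0..T}"
  shows "norm (direction x y t) \<le> C * T + 4 * a * T"
proof -
  note yc = y[unfolded admissible_def, THEN conjunct1]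
  have "norm (integral {0..t} (\<lambda>r. target x y r - y r)) \<le> 2 * a * T"
    by (intro norm_integral_le t continuous_intros target_cont yc norm_target_diff_le)
       (use y in \<open>auto simp: admissible_def\<close>)
  then show ?thesis unfolding direction_def
    using norm_triangle_ineq[of "drift x y" "integral {0..t} (\<lambda>r. target x y r - y r)"]
      norm_drift_le[OF y, of x] by linarith
qed

lemma direction_has_derivative:
  assumes "continuous_on {0..T} y" "t \<in> {0..T}"
  shows "(direction x y has_vector_derivative (target x y t - y t)) (at t within {0..T})"
  unfolding direction_def[abs_def]
  by (auto intro!: derivative_eq_intros integral_has_vector_derivative continuous_intros target_cont assms)

lemma direction_cont: "continuous_on {0..T} y \<Longrightarrow> continuous_on {0..T} (direction x y)"
  by (rule continuous_on_vector_derivative) (rule direction_has_derivative)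

lemma integral_direction:
  assumes "continuous_on {0..T} y"
  shows "integral {0..T} (direction x y) = T *\<^sub>R total_force x y"
proof -
  have "integral {0..T} (direction x y) = T *\<^sub>R drift x y
      + integral {0..T} (\<lambda>t. integral {0..t} (\<lambda>r. target x y r - y r))"
    unfolding direction_def[abs_def] using T_pos
    by (subst integral_add)
       (auto intro!: integrable_continuous_real indefinite_integral_continuous_1 continuous_intros target_cont assms)
  then show ?thesis using T_pos by (simp add: drift_def scaleR_diff_right)
qed

lemma traj_step:
  assumes y: "continuous_on {0..T} y" and t: "t \<in> {0..T}"
  shows "traj (x + s *\<^sub>R drift x y) (velocity_step s x y) t = traj x y t + s *\<^sub>R direction x y t"
proof -
  have c: "continuous_on {0..t} y" "continuous_on {0..t} (target x y)"
    using t by (auto intro: continuous_on_subset[OF y] continuous_on_subset[OF target_cont[OF y]])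
  have "integral {0..t} (velocity_step s x y)
      = integral {0..t} y + s *\<^sub>R integral {0..t} (\<lambda>r. target x y r - y r)"
    unfolding velocity_step_def[abs_def]
    by (subst integral_add) (auto intro!: integrable_continuous_real continuous_intros c)
  then show ?thesis by (simp add: traj_def direction_def scaleR_add_right)
qed

lemma integral_force_direction:
  assumes y: "continuous_on {0..T} y"
  shows "integral {0..T} (\<lambda>t. force x y t \<bullet> direction x y t)
    = (norm (total_force x y))\<^sup>2 - integral {0..T} (\<lambda>t. load x y t \<bullet> (target x y t - y t))"
proof -
  let ?c = "total_force x y" and ?d = "direction x y"
  have "((\<lambda>t. load x y t \<bullet> (target x y t - y t) + (force x y t - (1 / T) *\<^sub>R ?c) \<bullet> ?d t)
      has_integral (load x y T \<bullet> ?d T - load x y 0 \<bullet> ?d 0)) {0..T}"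
    by (rule fundamental_theorem_of_calculus[OF T_nonneg])
       (auto intro!: derivative_eq_intros load_has_derivative direction_has_derivative y
         bounded_bilinear.has_vector_derivative[OF bounded_bilinear_inner])
  then have "0 = integral {0..T} (\<lambda>t. (load x y t \<bullet> (target x y t - y t) + force x y t \<bullet> ?d t)
      - (1 / T) * (?c \<bullet> ?d t))"
    by (simp add: has_integral_iff inner_diff_left add_diff_eq)
  also have "\<dots> = integral {0..T} (\<lambda>t. load x y t \<bullet> (target x y t - y t))
      + integral {0..T} (\<lambda>t. force x y t \<bullet> ?d t) - (1 / T) * (?c \<bullet> integral {0..T} ?d)"
    by (subst integral_diff integral_add inner_integral_left;
        (intro integrable_continuous_real continuous_intros load_cont target_cont force_cont direction_cont y)?)+
       simp
  also have "?c \<bullet> integral {0..T} ?d = T * (norm ?c)\<^sup>2"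
    by (simp add: integral_direction[OF y] dot_square_norm)
  finally show ?thesis using T_pos by simp
qed

lemma F_mvt:
  assumes t: "t \<in> {0..T}"
  obtains r where "0 < r" "r < 1" "F t (x + d) - F t x = gradF t (x + r *\<^sub>R d) \<bullet> d"
proof -
  have "DERIV (\<lambda>r. F t (x + r *\<^sub>R d)) r :> gradF t (x + r *\<^sub>R d) \<bullet> d" for r
  proof -
    have "(F t has_derivative (\<lambda>h. h \<bullet> gradF t (x + r *\<^sub>R d))) (at (x + r *\<^sub>R d))"
      using F_gderiv[OF t] by (simp add: gderiv_def)
    then have "((\<lambda>r. F t (x + r *\<^sub>R d)) has_derivative (\<lambda>s. (s *\<^sub>R d) \<bullet> gradF t (x + r *\<^sub>R d))) (at r)"
      by (rule has_derivative_compose[rotated]) (auto intro!: derivative_eq_intros)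
    then show ?thesis
      by (simp add: has_field_derivative_def mult_commute_abs inner_commute)
  qed
  then obtain r where "0 < r" "r < 1"
    "F t (x + 1 *\<^sub>R d) - F t (x + 0 *\<^sub>R d) = (1 - 0) * (gradF t (x + r *\<^sub>R d) \<bullet> d)"
    using MVT2[of 0 1 "\<lambda>r. F t (x + r *\<^sub>R d)" "\<lambda>r. gradF t (x + r *\<^sub>R d) \<bullet> d"] by auto
  then show ?thesis using that by simp
qed

lemma F_lipschitz:
  assumes t: "t \<in> {0..T}"
  shows "\<bar>F t (x + d) - F t x\<bar> \<le> C * norm d"
proof -
  obtain r where "F t (x + d) - F t x = gradF t (x + r *\<^sub>R d) \<bullet> d" using F_mvt[OF t] by blast
  then have "\<bar>F t (x + d) - F t x\<bar> \<le> norm (gradF t (x + r *\<^sub>R d)) * norm d"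
    by (simp add: Cauchy_Schwarz_ineq2)
  also have "\<dots> \<le> C * norm d" by (intro mult_right_mono gradF_bound t norm_ge_zero)
  finally show ?thesis .
qed

lemma F_abs_le: "t \<in> {0..T} \<Longrightarrow> \<bar>F t x\<bar> \<le> C * norm x"
  using F_lipschitz[of t 0 x] F_zero by simp

lemma norm_traj_diff_le: "admissible y \<Longrightarrow> t \<in> {0..T} \<Longrightarrow> norm (integral {0..t} y) \<le> a * T"
  by (intro norm_integral_le) (auto simp: admissible_def)

lemma admissible_step:
  assumes y: "admissible y" and s: "0 \<le> s" "s \<le> 1"
  shows "admissible (velocity_step s x y)"
proof -
  note yc = y[unfolded admissible_def, THEN conjunct1]
  have eq: "velocity_step s x y t = (1 - s) *\<^sub>R y t + s *\<^sub>R target x y t" for t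
    by (simp add: velocity_step_def algebra_simps)
  have "norm (velocity_step s x y t) \<le> a" if t: "t \<in> {0..T}" for t
  proof -
    have "velocity_step s x y t \<in> cball 0 a" unfolding eq
      using y t s norm_target_less[of x y t]
      by (intro convexD[OF convex_cball]) (auto simp: admissible_def less_imp_le)
    then show ?thesis by simp
  qed
  moreover have "integral {0..T} (velocity_step s x y)
      = (1 - s) *\<^sub>R integral {0..T} y + s *\<^sub>R integral {0..T} (target x y)"
    unfolding eq
    by (subst integral_add) (auto intro!: integrable_continuous_real continuous_intros target_cont yc)
  then have "integral {0..T} (velocity_step s x y) \<in> D"
    using y target_subgrad[OF yc, of x] s
    by (auto simp: admissible_def subgrad_def intro!: convexD[OF convex_D])
  moreover have "continuous_on {0..T} (velocity_step s x y)"
    unfolding velocity_step_def[abs_def] by (intro continuous_intros target_cont yc)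
  ultimately show ?thesis unfolding admissible_def by blast
qed

lemma \<Phi>_cont_compose:
  "continuous_on {0..T} y \<Longrightarrow> (\<And>t. t \<in> {0..T} \<Longrightarrow> norm (y t) \<le> a) \<Longrightarrow> continuous_on {0..T} (\<lambda>t. \<Phi> (y t))"
  by (rule continuous_on_compose2[OF \<Phi>_cont]) auto

lemma bregman_cont:
  assumes y: "admissible y"
  shows "continuous_on {0..T} (\<lambda>t. bregman (y t) (target x y t))"
  unfolding bregman_def \<phi>_target
  using y norm_target_less[of x y]
  by (intro continuous_intros \<Phi>_cont_compose target_cont load_cont) (auto simp: admissible_def less_imp_le)

lemma gap_nonneg: "admissible y \<Longrightarrow> gap x y \<ge> 0"
  unfolding gap_def
  by (intro add_nonneg_nonneg zero_le_power2 integral_nonneg integrable_continuous_real bregman_cont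
      bregman_nonneg norm_target_less) (auto simp: admissible_def)

lemma kinetic_step:
  assumes y: "admissible y" and s: "0 \<le> s" "s \<le> 1"
  shows "integral {0..T} (\<lambda>t. \<Phi> (velocity_step s x y t)) + J (integral {0..T} (velocity_step s x y))
    \<le> integral {0..T} (\<lambda>t. \<Phi> (y t)) + J (integral {0..T} y)
      - s * (integral {0..T} (\<lambda>t. bregman (y t) (target x y t))
             + integral {0..T} (\<lambda>t. load x y t \<bullet> (target x y t - y t)))"
proof -
  note yc = y[unfolded admissible_def, THEN conjunct1]
  let ?z = "target x y" and ?q = "multiplier (load x y)"
  let ?V = "integral {0..T} y" and ?W = "integral {0..T} ?z"
  have ya: "norm (y t) \<le> a" if "t \<in> {0..T}" for t using y that by (auto simp: admissible_def)
  note za = less_imp_le[OF norm_target_less]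
  have int: "(\<lambda>t. \<Phi> (y t)) integrable_on {0..T}" "(\<lambda>t. \<Phi> (?z t)) integrable_on {0..T}"
      "y integrable_on {0..T}" "?z integrable_on {0..T}"
      "(\<lambda>t. bregman (y t) (?z t)) integrable_on {0..T}"
      "(\<lambda>t. load x y t \<bullet> (?z t - y t)) integrable_on {0..T}"
      "(\<lambda>t. ?q \<bullet> (?z t - y t)) integrable_on {0..T}"
    by (intro integrable_continuous_real continuous_intros \<Phi>_cont_compose target_cont load_cont
        yc ya za bregman_cont y; simp)+
  have "integral {0..T} (\<lambda>t. \<Phi> (velocity_step s x y t))
      \<le> integral {0..T} (\<lambda>t. \<Phi> (y t) + s * (\<Phi> (?z t) - \<Phi> (y t)))"
  proof (intro integral_le)
    show "(\<lambda>t. \<Phi> (velocity_step s x y t)) integrable_on {0..T}"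
      using admissible_step[OF y s, of x]
      by (intro integrable_continuous_real \<Phi>_cont_compose) (auto simp: admissible_def)
    show "(\<lambda>t. \<Phi> (y t) + s * (\<Phi> (?z t) - \<Phi> (y t))) integrable_on {0..T}"
      by (intro integrable_add integrable_diff integrable_on_mult_right int)
    show "\<Phi> (velocity_step s x y t) \<le> \<Phi> (y t) + s * (\<Phi> (?z t) - \<Phi> (y t))" if "t \<in> {0..T}" for t
      unfolding velocity_step_def by (intro \<Phi>_convexD za ya that s)
  qed
  also have "\<dots> = integral {0..T} (\<lambda>t. \<Phi> (y t)) + s * integral {0..T} (\<lambda>t. \<Phi> (?z t) - \<Phi> (y t))"
    using int by (simp add: integral_add integrable_diff integrable_on_mult_right)
  also have "integral {0..T} (\<lambda>t. \<Phi> (?z t) - \<Phi> (y t))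
      = integral {0..T} (\<lambda>t. ?q \<bullet> (?z t - y t) - bregman (y t) (?z t) - load x y t \<bullet> (?z t - y t))"
    by (rule integral_cong)
       (simp add: bregman_def \<phi>_target inner_diff_left inner_diff_right)
  also have "\<dots> = ?q \<bullet> (?W - ?V) - integral {0..T} (\<lambda>t. bregman (y t) (?z t))
      - integral {0..T} (\<lambda>t. load x y t \<bullet> (?z t - y t))"
    using int by (simp add: integral_diff integrable_diff inner_integral_left flip: integral_diff)
  finally have 1: "integral {0..T} (\<lambda>t. \<Phi> (velocity_step s x y t)) \<le> integral {0..T} (\<lambda>t. \<Phi> (y t))
      + s * (?q \<bullet> (?W - ?V) - integral {0..T} (\<lambda>t. bregman (y t) (?z t))
      - integral {0..T} (\<lambda>t. load x y t \<bullet> (?z t - y t)))" .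
  have "integral {0..T} (velocity_step s x y) = (1 - s) *\<^sub>R ?V + s *\<^sub>R ?W"
  proof -
    have "integral {0..T} (velocity_step s x y) = ?V + s *\<^sub>R (?W - ?V)"
      unfolding velocity_step_def[abs_def] using int
      by (simp add: integral_add integrable_diff integrable_cmul integral_diff)
    then show ?thesis by (simp add: algebra_simps)
  qed
  moreover have "?V \<in> D" "subgrad ?W (- ?q)"
    using y target_subgrad[OF yc] by (auto simp: admissible_def)
  ultimately have "J (integral {0..T} (velocity_step s x y)) \<le> (1 - s) * J ?V + s * J ?W"
    using convex_onD[OF convex_J, of s ?V ?W] s by (simp add: subgrad_def)
  also have "\<dots> \<le> (1 - s) * J ?V + s * (J ?V - ?q \<bullet> (?W - ?V))"
    using \<open>subgrad ?W (- ?q)\<close> \<open>?V \<in> D\<close> s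
    by (intro add_left_mono mult_left_mono) (auto simp: subgrad_def inner_diff_right)
  finally show ?thesis using 1 by (simp add: algebra_simps)
qed

lemma descent:
  assumes \<eta>: "\<eta> > 0"
  obtains \<tau> where "0 < \<tau>" "\<tau> \<le> 1"
    "\<And>x y s. admissible y \<Longrightarrow> norm x \<le> R \<Longrightarrow> 0 \<le> s \<Longrightarrow> s \<le> \<tau> \<Longrightarrow>
      energy (x + s *\<^sub>R drift x y) (velocity_step s x y) \<le> energy x y - s * (gap x y - \<eta>)"
proof -
  define L where "L = C * T + 4 * a * T"
  have L: "L > 0" using C_nonneg a_pos T_pos by (simp add: L_def add_nonneg_pos)
  let ?K = "{0..T} \<times> cball (0::'a) (R + a * T + L)"
  have "uniformly_continuous_on ?K (\<lambda>(t, x). gradF t x)"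
    by (intro compact_uniformly_continuous compact_Times continuous_on_subset[OF gradF_cont]) auto
  moreover define \<epsilon> where "\<epsilon> = \<eta> / (T * L)"
  moreover have "\<epsilon> > 0" using \<eta> L T_pos by (simp add: \<epsilon>_def)
  ultimately obtain \<delta> where \<delta>: "\<delta> > 0" "\<And>z z'. z \<in> ?K \<Longrightarrow> z' \<in> ?K \<Longrightarrow> dist z' z < \<delta> \<Longrightarrow>
      dist (case z' of (t, x) \<Rightarrow> gradF t x) (case z of (t, x) \<Rightarrow> gradF t x) < \<epsilon>"
    unfolding uniformly_continuous_on_def by blast
  define \<tau> where "\<tau> = min 1 (\<delta> / (2 * L))"
  have \<tau>: "0 < \<tau>" "\<tau> \<le> 1" "\<tau> * L < \<delta>"
  proof -
    have "\<tau> * L \<le> \<delta> / (2 * L) * L" unfolding \<tau>_def using L by (intro mult_right_mono) auto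
    then show "\<tau> * L < \<delta>" using L \<delta>(1) by simp
  qed (use \<delta>(1) L in \<open>auto simp: \<tau>_def\<close>)
  show ?thesis
  proof (rule that[OF \<tau>(1,2)])
    fix x :: 'a and y s
    assume y: "admissible y" and x: "norm x \<le> R" and s: "0 \<le> s" "s \<le> \<tau>"
    note yc = y[unfolded admissible_def, THEN conjunct1]
    let ?d = "direction x y" and ?u = "traj x y"
    have F_ge: "F t (?u t + s *\<^sub>R ?d t) \<ge> F t (?u t) + s * (force x y t \<bullet> ?d t) - s * (\<eta> / T)"
      if t: "t \<in> {0..T}" for t
    proof -
      obtain r where r: "0 < r" "r < 1"
        "F t (?u t + s *\<^sub>R ?d t) - F t (?u t) = gradF t (?u t + r *\<^sub>R (s *\<^sub>R ?d t)) \<bullet> (s *\<^sub>R ?d t)"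
        using F_mvt[OF t] by blast
      have d: "norm (?d t) \<le> L" unfolding L_def by (rule norm_direction_le[OF y t])
      have u: "norm (?u t) \<le> R + a * T"
        unfolding traj_def using x norm_traj_diff_le[OF y t] by (intro norm_triangle_mono)
      have "norm (r *\<^sub>R (s *\<^sub>R ?d t)) = r * (s * norm (?d t))" using r s by simp
      also have "\<dots> \<le> 1 * (s * norm (?d t))" using r s by (intro mult_right_mono) auto
      also have "\<dots> \<le> \<tau> * L" unfolding mult_1
        using s d by (intro mult_mono) (use \<tau> in auto)
      finally have n: "norm (r *\<^sub>R (s *\<^sub>R ?d t)) \<le> \<tau> * L" .
      moreover have "\<tau> * L \<le> L" using \<tau> L by (simp add: mult_left_le_one_le)
      ultimately have "norm (?u t + r *\<^sub>R (s *\<^sub>R ?d t)) \<le> R + a * T + L"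
        using u by (intro norm_triangle_mono) linarith+
      moreover have "norm (?u t) \<le> R + a * T + L" using u L by linarith
      ultimately have "(t, ?u t) \<in> ?K" "(t, ?u t + r *\<^sub>R (s *\<^sub>R ?d t)) \<in> ?K" using t by auto
      from \<delta>(2)[OF this] have "dist (gradF t (?u t + r *\<^sub>R (s *\<^sub>R ?d t))) (gradF t (?u t)) < \<epsilon>"
        using n \<tau>(3) by (simp add: dist_Pair_Pair dist_norm)
      then have g: "norm (gradF t (?u t + r *\<^sub>R (s *\<^sub>R ?d t)) - force x y t) \<le> \<epsilon>"
        by (simp add: dist_norm force_def)
      have "\<bar>(gradF t (?u t + r *\<^sub>R (s *\<^sub>R ?d t)) - force x y t) \<bullet> ?d t\<bar> \<le> \<epsilon> * L"
        using \<open>\<epsilon> > 0\<close> by (intro order_trans[OF Cauchy_Schwarz_ineq2] mult_mono g d) auto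
      also have "\<epsilon> * L = \<eta> / T" using L by (simp add: \<epsilon>_def)
      finally have "gradF t (?u t + r *\<^sub>R (s *\<^sub>R ?d t)) \<bullet> ?d t \<ge> force x y t \<bullet> ?d t - \<eta> / T"
        by (simp add: inner_diff_left)
      then have "s * (gradF t (?u t + r *\<^sub>R (s *\<^sub>R ?d t)) \<bullet> ?d t) \<ge> s * (force x y t \<bullet> ?d t - \<eta> / T)"
        using s by (intro mult_left_mono)
      then show ?thesis using r(3) by (simp add: right_diff_distrib)
    qed
    have "integral {0..T} (\<lambda>t. F t (?u t)) + s * integral {0..T} (\<lambda>t. force x y t \<bullet> ?d t) - s * \<eta>
        = integral {0..T} (\<lambda>t. F t (?u t) + s * (force x y t \<bullet> ?d t) - s * (\<eta> / T))"
    proof -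
      have "(\<lambda>t. F t (?u t)) integrable_on {0..T}" "(\<lambda>t. s * (force x y t \<bullet> ?d t)) integrable_on {0..T}"
        by (intro integrable_continuous_real continuous_intros F_cont_compose traj_cont force_cont direction_cont yc)+
      moreover from this have "(\<lambda>t. F t (?u t) + s * (force x y t \<bullet> ?d t)) integrable_on {0..T}"
        by (rule integrable_add)
      ultimately show ?thesis using T_pos
        by (simp only: integral_diff[OF _ integrable_const_ivl] integral_add) simp
    qed
    also have "\<dots> \<le> integral {0..T} (\<lambda>t. F t (?u t + s *\<^sub>R ?d t))"
      by (intro integral_le integrable_continuous_real continuous_intros F_cont_compose traj_cont
          force_cont direction_cont yc F_ge)
    also have "\<dots> = integral {0..T} (\<lambda>t. F t (traj (x + s *\<^sub>R drift x y) (velocity_step s x y) t))"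
      by (rule integral_cong) (simp add: traj_step[OF yc])
    finally show "energy (x + s *\<^sub>R drift x y) (velocity_step s x y) \<le> energy x y - s * (gap x y - \<eta>)"
      using kinetic_step[OF y s(1) order_trans[OF s(2) \<tau>(2)], of x]
      unfolding integral_force_direction[OF yc] energy_def gap_def
      by (simp add: algebra_simps)
  qed
qed

end

section \<open>Continuity of the descent step and the minimax argument\<close>

lemma uniform_limit_const_tendsto:
  fixes x :: "'a::metric_space"
  shows "(f \<longlongrightarrow> x) F \<Longrightarrow> uniform_limit S (\<lambda>k t. f k) (\<lambda>t. x) F"
  by (rule uniform_limitI) (auto dest!: tendstoD elim!: eventually_mono)

lemma uniform_limit_scaleR_continuous:
  fixes g :: "'i \<Rightarrow> real \<Rightarrow> 'a::real_normed_vector"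
  assumes "compact S" "uniform_limit S f l F" "uniform_limit S g m F"
    and "continuous_on S l" "continuous_on S m"
  shows "uniform_limit S (\<lambda>k t. f k t *\<^sub>R g k t) (\<lambda>t. l t *\<^sub>R m t) F"
  using assms by (intro bounded_bilinear.bounded_uniform_limit[OF bounded_bilinear_scaleR]
      compact_imp_bounded compact_continuous_image)

context forced_boundary_problem
begin

lemma uniform_limit_traj:
  assumes y: "continuous_on {0..T} y" and yk: "\<And>k. continuous_on {0..T} (yk k)"
    and "(xk \<longlongrightarrow> x) \<F>" "uniform_limit {0..T} yk y \<F>"
  shows "uniform_limit {0..T} (\<lambda>k. traj (xk k) (yk k)) (traj x y) \<F>"
  unfolding traj_def[abs_def]
  by (intro uniform_limit_add uniform_limit_const_tendsto uniform_limit_indefinite_integral T_nonneg assms)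

context
  fixes xk :: "'i \<Rightarrow> 'a" and yk :: "'i \<Rightarrow> real \<Rightarrow> 'a" and u :: "real \<Rightarrow> 'a" and \<F> :: "'i filter"
    and h c H
  assumes yk: "\<And>k. continuous_on {0..T} (yk k)" and u: "continuous_on {0..T} u"
    and lim: "uniform_limit {0..T} (\<lambda>k. traj (xk k) (yk k)) u \<F>"
  defines "h \<equiv> \<lambda>t. gradF t (u t)"
    and "c \<equiv> integral {0..T} h"
    and "H \<equiv> \<lambda>t. integral {0..t} h - (t / T) *\<^sub>R c"
begin

lemma limit_force_cont: "continuous_on {0..T} h"
  unfolding h_def by (rule gradF_cont_compose[OF u])

lemma limit_load_cont: "continuous_on {0..T} H"
  unfolding H_def using T_pos
  by (intro continuous_intros indefinite_integral_continuous_1 integrable_continuous_real limit_force_cont) simp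

lemma uniform_limit_force_integral:
  "uniform_limit {0..T} (\<lambda>k t. integral {0..t} (force (xk k) (yk k))) (\<lambda>t. integral {0..t} h) \<F>"
proof -
  have "uniform_limit {0..T} (\<lambda>k. force (xk k) (yk k)) h \<F>"
    using uniform_limit_continuous_compose[OF compact_Icc gradF_cont lim u]
    by (simp add: force_def[abs_def] h_def)
  then show ?thesis
    by (intro uniform_limit_indefinite_integral T_nonneg force_cont yk limit_force_cont)
qed

lemma tendsto_total_force: "((\<lambda>k. total_force (xk k) (yk k)) \<longlongrightarrow> c) \<F>"
  unfolding total_force_def c_def using T_nonneg
  by (intro tendsto_uniform_limitI[OF uniform_limit_force_integral]) auto

lemma uniform_limit_load: "uniform_limit {0..T} (\<lambda>k. load (xk k) (yk k)) H \<F>"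
  unfolding load_def[abs_def] H_def using T_pos
  by (intro uniform_limit_minus uniform_limit_force_integral uniform_limit_scaleR_continuous
      uniform_limit_const uniform_limit_const_tendsto tendsto_total_force continuous_intros compact_Icc) simp

lemma tendsto_multiplier_load: "((\<lambda>k. multiplier (load (xk k) (yk k))) \<longlongrightarrow> multiplier H) \<F>"
  by (intro tendsto_multiplier limit_load_cont load_cont yk uniform_limit_load)

lemma uniform_limit_target:
  "uniform_limit {0..T} (\<lambda>k. target (xk k) (yk k)) (\<lambda>t. \<psi> (multiplier H - H t)) \<F>"
proof -
  have "uniform_limit {0..T} (\<lambda>k t. multiplier (load (xk k) (yk k)) - load (xk k) (yk k) t)
      (\<lambda>t. multiplier H - H t) \<F>"
    by (intro uniform_limit_minus uniform_limit_const_tendsto tendsto_multiplier_load uniform_limit_load)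
  moreover have "continuous_on ({0..T} \<times> UNIV) (\<lambda>z. \<psi> (snd z))"
    by (intro \<psi>_continuous_compose continuous_intros)
  moreover have "continuous_on {0..T} (\<lambda>t. multiplier H - H t)"
    by (intro continuous_intros limit_load_cont)
  ultimately show ?thesis
    using uniform_limit_continuous_compose[of "{0..T}" "\<lambda>z. \<psi> (snd z)"]
    by (simp add: target_def[abs_def])
qed

end

lemma uniform_limit_target_traj:
  assumes y: "continuous_on {0..T} y" and yk: "\<And>k. continuous_on {0..T} (yk k)"
    and lim: "(xk \<longlongrightarrow> x) \<F>" "uniform_limit {0..T} yk y \<F>"
  shows "((\<lambda>k. total_force (xk k) (yk k)) \<longlongrightarrow> total_force x y) \<F>"
    and "uniform_limit {0..T} (\<lambda>k. target (xk k) (yk k)) (target x y) \<F>"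
  using tendsto_total_force[OF yk traj_cont[OF y] uniform_limit_traj[OF y yk lim]]
    uniform_limit_target[OF yk traj_cont[OF y] uniform_limit_traj[OF y yk lim]]
  unfolding target_def[abs_def] load_def[abs_def] total_force_def force_def[abs_def] by auto

lemma tendsto_drift:
  assumes y: "continuous_on {0..T} y" and yk: "\<And>k. continuous_on {0..T} (yk k)"
    and lim: "(xk \<longlongrightarrow> x) \<F>" "uniform_limit {0..T} yk y \<F>"
  shows "((\<lambda>k. drift (xk k) (yk k)) \<longlongrightarrow> drift x y) \<F>"
proof -
  have c: "continuous_on {0..T} (\<lambda>t. target x y t - y t)" if "continuous_on {0..T} y" for x y
    by (intro continuous_intros target_cont that)
  have c2: "continuous_on {0..T} (\<lambda>t. integral {0..t} (\<lambda>r. target x y r - y r))"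
    if "continuous_on {0..T} y" for x y
    by (intro indefinite_integral_continuous_1 integrable_continuous_real c that)
  have "uniform_limit {0..T} (\<lambda>k t. target (xk k) (yk k) t - yk k t) (\<lambda>t. target x y t - y t) \<F>"
    by (intro uniform_limit_minus uniform_limit_target_traj assms)
  then have "uniform_limit {0..T} (\<lambda>k t. integral {0..t} (\<lambda>t. integral {0..t} (\<lambda>r. target (xk k) (yk k) r - yk k r)))
      (\<lambda>t. integral {0..t} (\<lambda>t. integral {0..t} (\<lambda>r. target x y r - y r))) \<F>"
    by (intro uniform_limit_indefinite_integral T_nonneg c c2 y yk)
  from tendsto_uniform_limitI[OF this, of T] show ?thesis
    unfolding drift_def using T_nonneg
    by (intro tendsto_intros uniform_limit_target_traj assms) auto
qed

definition cutoff :: "real \<Rightarrow> 'a \<Rightarrow> real"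
  where "cutoff R x = max 0 (min 1 (R + 1 - norm x))"

lemma cutoff_range: "0 \<le> cutoff R x" "cutoff R x \<le> 1"
  by (auto simp: cutoff_def)

primrec orbit :: "real \<Rightarrow> real \<Rightarrow> 'a \<Rightarrow> nat \<Rightarrow> 'a \<times> (real \<Rightarrow> 'a)"
  where "orbit \<tau> R \<xi> 0 = (\<xi>, \<lambda>t. 0)"
  | "orbit \<tau> R \<xi> (Suc n) = (case orbit \<tau> R \<xi> n of (x, y) \<Rightarrow>
      (x + (\<tau> * cutoff R x) *\<^sub>R drift x y, velocity_step (\<tau> * cutoff R x) x y))"

lemma admissible_zero: "admissible (\<lambda>t. 0)"
  using a_pos zero_in_D by (auto simp: admissible_def)

context
  fixes \<tau> R :: real
  assumes \<tau>: "0 < \<tau>" "\<tau> \<le> 1"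
begin

lemma step_size: "0 \<le> \<tau> * cutoff R x" "\<tau> * cutoff R x \<le> \<tau>"
  using \<tau> cutoff_range[of R x] by (auto simp: mult_left_le)

lemma admissible_orbit: "admissible (snd (orbit \<tau> R \<xi> n))"
  using step_size \<tau>
  by (induction n) (auto simp: admissible_zero split: prod.split intro!: admissible_step order_trans[OF step_size(2) \<tau>(2)])

lemma norm_orbit_diff_le: "norm (fst (orbit \<tau> R \<xi> n) - \<xi>) \<le> real n * (C * T + 2 * a * T)"
proof (induction n)
  case (Suc n)
  obtain x y where xy: "orbit \<tau> R \<xi> n = (x, y)" by force
  then have y: "admissible y" using admissible_orbit[of \<xi> n] by simp
  have "norm ((\<tau> * cutoff R x) *\<^sub>R drift x y) = (\<tau> * cutoff R x) * norm (drift x y)"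
    using step_size(1)[of x] by simp
  also have "\<dots> \<le> 1 * (C * T + 2 * a * T)"
    using order_trans[OF step_size(2) \<tau>(2), of x] norm_drift_le[OF y, of x] by (intro mult_mono) auto
  finally have "norm ((x - \<xi>) + (\<tau> * cutoff R x) *\<^sub>R drift x y)
      \<le> real n * (C * T + 2 * a * T) + 1 * (C * T + 2 * a * T)"
    using Suc xy by (intro norm_triangle_mono) auto
  then show ?case by (simp add: xy algebra_simps)
qed simp

lemma orbit_tendsto:
  "((\<lambda>\<xi>. fst (orbit \<tau> R \<xi> n)) \<longlongrightarrow> fst (orbit \<tau> R \<xi>0 n)) (at \<xi>0) \<and>
   uniform_limit {0..T} (\<lambda>\<xi>. snd (orbit \<tau> R \<xi> n)) (snd (orbit \<tau> R \<xi>0 n)) (at \<xi>0)"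
proof (induction n)
  case 0
  show ?case by (auto intro: uniform_limit_const)
next
  case (Suc n)
  let ?x = "\<lambda>\<xi>. fst (orbit \<tau> R \<xi> n)" and ?y = "\<lambda>\<xi>. snd (orbit \<tau> R \<xi> n)"
  let ?s = "\<lambda>\<xi>. \<tau> * cutoff R (?x \<xi>)"
  have x: "(?x \<longlongrightarrow> ?x \<xi>0) (at \<xi>0)" and y: "uniform_limit {0..T} ?y (?y \<xi>0) (at \<xi>0)"
    using Suc by auto
  have yc: "continuous_on {0..T} (?y \<xi>)" for \<xi>
    using admissible_orbit[of \<xi> n] by (auto simp: admissible_def)
  have s: "(?s \<longlongrightarrow> ?s \<xi>0) (at \<xi>0)"
    unfolding cutoff_def by (intro tendsto_intros x)
  have "((\<lambda>\<xi>. ?x \<xi> + ?s \<xi> *\<^sub>R drift (?x \<xi>) (?y \<xi>)) \<longlongrightarrow> ?x \<xi>0 + ?s \<xi>0 *\<^sub>R drift (?x \<xi>0) (?y \<xi>0)) (at \<xi>0)"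
    by (intro tendsto_intros x s tendsto_drift yc y)
  moreover have "uniform_limit {0..T} (\<lambda>\<xi>. velocity_step (?s \<xi>) (?x \<xi>) (?y \<xi>))
      (velocity_step (?s \<xi>0) (?x \<xi>0) (?y \<xi>0)) (at \<xi>0)"
    unfolding velocity_step_def[abs_def]
    by (intro uniform_limit_add uniform_limit_scaleR_continuous uniform_limit_minus y compact_Icc
        uniform_limit_const_tendsto s uniform_limit_target_traj x yc continuous_intros target_cont)
  ultimately show ?case by (simp add: case_prod_unfold)
qed

lemma orbit_hits_zero: obtains \<xi> where "fst (orbit \<tau> R \<xi> n) = 0"
proof (rule zero_of_bounded_displacement[of "\<lambda>\<xi>. fst (orbit \<tau> R \<xi> n)"])
  show "continuous_on UNIV (\<lambda>\<xi>. fst (orbit \<tau> R \<xi> n))"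
    using orbit_tendsto by (simp add: continuous_on_def)
qed (rule norm_orbit_diff_le that; assumption?)+

end

lemma energy_zero_le: "energy \<xi> (\<lambda>t. 0) \<le> T * (C * norm \<xi>)"
proof -
  have "- (C * norm \<xi>) \<le> F t \<xi>" if "t \<in> {0..T}" for t
    using F_abs_le[OF that, of \<xi>] by linarith
  then have "integral {0..T} (\<lambda>t. - (C * norm \<xi>)) \<le> integral {0..T} (\<lambda>t. F t \<xi>)"
    by (intro integral_le integrable_continuous_real continuous_intros F_cont_compose)
  moreover have "T * \<Phi> 0 \<le> 0"
    using \<Phi>_nonpos[of 0] T_pos a_pos by (simp add: mult_nonneg_nonpos)
  ultimately show ?thesis using T_pos
    by (simp add: energy_def traj_def J_zero algebra_simps)
qed

lemma energy_ge:
  assumes y: "admissible y"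
  shows "energy 0 y \<ge> T * \<Phi>min - T * (C * (a * T))"
proof -
  note yc = y[unfolded admissible_def, THEN conjunct1]
  have "integral {0..T} (\<lambda>t. \<Phi>min) \<le> integral {0..T} (\<lambda>t. \<Phi> (y t))"
    using y by (intro integral_le integrable_continuous_real continuous_intros \<Phi>_cont_compose \<Phi>min_le)
       (auto simp: admissible_def)
  moreover have "integral {0..T} (\<lambda>t. F t (traj 0 y t)) \<le> integral {0..T} (\<lambda>t. C * (a * T))"
  proof (intro integral_le integrable_continuous_real continuous_intros F_cont_compose traj_cont yc)
    fix t assume t: "t \<in> {0..T}"
    have "F t (traj 0 y t) \<le> C * norm (traj 0 y t)" using F_abs_le[OF t] by (simp add: abs_le_iff)
    also have "\<dots> \<le> C * (a * T)"
      unfolding traj_def using norm_traj_diff_le[OF y t] C_nonneg by (intro mult_left_mono) auto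
    finally show "F t (traj 0 y t) \<le> C * (a * T)" .
  qed
  moreover have "J (integral {0..T} y) \<ge> 0" using y J_nonneg by (simp add: admissible_def)
  ultimately show ?thesis using T_pos by (simp add: energy_def algebra_simps)
qed

lemma superlevel_bounded:
  obtains R where "\<And>x y. admissible y \<Longrightarrow> energy x y \<ge> b \<Longrightarrow> norm x \<le> R"
proof -
  have "\<forall>\<^sub>F x in at_infinity. integral {0..T} (\<lambda>t. F t x) > M - b + T * (C * (a * T))"
    using F_coercive by (simp add: filterlim_at_top_dense)
  then obtain R where R: "\<And>x. norm x \<ge> R \<Longrightarrow> integral {0..T} (\<lambda>t. F t x) > M - b + T * (C * (a * T))"
    unfolding eventually_at_infinity by blast
  have "norm x \<le> R" if y: "admissible y" and E: "energy x y \<ge> b" for x y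
  proof (rule ccontr)
    assume "\<not> norm x \<le> R"
    then have 1: "integral {0..T} (\<lambda>t. F t x) > M - b + T * (C * (a * T))" by (intro R) auto
    note yc = y[unfolded admissible_def, THEN conjunct1]
    have "integral {0..T} (\<lambda>t. F t x) - T * (C * (a * T)) = integral {0..T} (\<lambda>t. F t x - C * (a * T))"
      using T_pos by (subst integral_diff) (auto intro!: integrable_continuous_real F_cont_compose continuous_intros)
    also have "\<dots> \<le> integral {0..T} (\<lambda>t. F t (traj x y t))"
    proof (intro integral_le integrable_continuous_real continuous_intros F_cont_compose traj_cont yc)
      fix t assume t: "t \<in> {0..T}"
      have "\<bar>F t (traj x y t) - F t x\<bar> \<le> C * norm (integral {0..t} y)"
        unfolding traj_def by (rule F_lipschitz[OF t])
      also have "\<dots> \<le> C * (a * T)"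
        using norm_traj_diff_le[OF y t] C_nonneg by (rule mult_left_mono)
      finally show "F t x - C * (a * T) \<le> F t (traj x y t)" by (simp add: abs_le_iff)
    qed
    finally have 2: "integral {0..T} (\<lambda>t. F t x) - T * (C * (a * T)) \<le> integral {0..T} (\<lambda>t. F t (traj x y t))" .
    have "integral {0..T} (\<lambda>t. \<Phi> (y t)) \<le> integral {0..T} (\<lambda>t. 0)"
      using y by (intro integral_le integrable_continuous_real continuous_intros \<Phi>_cont_compose \<Phi>_nonpos)
         (auto simp: admissible_def)
    moreover have "J (integral {0..T} y) \<le> M" using y J_le by (simp add: admissible_def)
    ultimately show False using 1 2 E by (simp add: energy_def)
  qed
  then show ?thesis by (rule that)
qed

text \<open>If every gap were at least \<open>\<delta>\<close>, each step starting in the ball of radius \<open>R\<close> would lower the energy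
  by a fixed amount; but an orbit of any length that ends at first component \<open>0\<close> stays at levels at
  least \<open>b\<close>, hence in that ball.\<close>

lemma small_gap_exists:
  obtains R where "\<And>\<delta>. \<delta> > 0 \<Longrightarrow> \<exists>x y. admissible y \<and> norm x \<le> R \<and> gap x y < \<delta>"
proof -
  define b where "b = T * \<Phi>min - T * (C * (a * T))"
  obtain R where R: "\<And>x y. admissible y \<Longrightarrow> energy x y \<ge> b \<Longrightarrow> norm x \<le> R"
    using superlevel_bounded by blast
  have "\<exists>x y. admissible y \<and> norm x \<le> R + 1 \<and> gap x y < \<delta>" if \<delta>: "\<delta> > 0" for \<delta>
  proof (rule ccontr)
    assume no: "\<not> ?thesis"
    obtain \<tau> where \<tau>: "0 < \<tau>" "\<tau> \<le> 1" and desc: "\<And>x y s. admissible y \<Longrightarrow> norm x \<le> R + 1 \<Longrightarrow>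
        0 \<le> s \<Longrightarrow> s \<le> \<tau> \<Longrightarrow>
        energy (x + s *\<^sub>R drift x y) (velocity_step s x y) \<le> energy x y - s * (gap x y - \<delta> / 2)"
      using descent[of "\<delta> / 2" "R + 1"] \<delta> by auto
    define E where "E \<xi> n = energy (fst (orbit \<tau> R \<xi> n)) (snd (orbit \<tau> R \<xi> n))" for \<xi> n
    have E_step: "E \<xi> (Suc n) \<le> E \<xi> n - \<tau> * cutoff R (fst (orbit \<tau> R \<xi> n)) * (\<delta> / 2)" for \<xi> n
    proof -
      obtain x y where xy: "orbit \<tau> R \<xi> n = (x, y)" by force
      then have y: "admissible y" using admissible_orbit[OF \<tau>, of R \<xi> n] by simp
      let ?s = "\<tau> * cutoff R x"
      have "energy (x + ?s *\<^sub>R drift x y) (velocity_step ?s x y) \<le> energy x y - ?s * (\<delta> / 2)"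
      proof (cases "norm x \<le> R + 1")
        case True
        then have "\<delta> \<le> gap x y" using no y by (meson not_le)
        then have "?s * (\<delta> / 2) \<le> ?s * (gap x y - \<delta> / 2)"
          using step_size(1)[OF \<tau>] by (intro mult_left_mono) auto
        then show ?thesis using desc[OF y True step_size[OF \<tau>]] by (smt (verit))
      next
        case False
        then have "cutoff R x = 0" by (simp add: cutoff_def)
        then show ?thesis by (simp add: velocity_step_def[abs_def])
      qed
      then show ?thesis by (simp add: E_def xy)
    qed
    obtain n :: nat where n: "real n * (\<tau> * (\<delta> / 2)) > T * (C * R) - b"
      using reals_Archimedean3[OF mult_pos_pos[OF \<tau>(1) half_gt_zero[OF \<delta>]]] by blast
    obtain \<xi> where \<xi>: "fst (orbit \<tau> R \<xi> n) = 0" using orbit_hits_zero[OF \<tau>] by blast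
    have "E \<xi> n \<ge> b" unfolding E_def \<xi> b_def by (rule energy_ge[OF admissible_orbit[OF \<tau>]])
    have "decseq (E \<xi>)"
    proof (rule decseq_SucI)
      fix k
      have "\<tau> * cutoff R (fst (orbit \<tau> R \<xi> k)) * (\<delta> / 2) \<ge> 0"
        by (intro mult_nonneg_nonneg[OF step_size(1)[OF \<tau>]]) (use \<delta> in auto)
      then show "E \<xi> (Suc k) \<le> E \<xi> k" using E_step[of \<xi> k] by linarith
    qed
    then have E_ge: "E \<xi> k \<ge> b" if "k \<le> n" for k
      using decseqD[OF \<open>decseq (E \<xi>)\<close> that] \<open>E \<xi> n \<ge> b\<close> by linarith
    have x_le: "norm (fst (orbit \<tau> R \<xi> k)) \<le> R" if "k \<le> n" for k
      using E_ge[OF that] by (intro R[OF admissible_orbit[OF \<tau>]]) (simp add: E_def)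
    have "E \<xi> k \<le> E \<xi> 0 - real k * (\<tau> * (\<delta> / 2))" if "k \<le> n" for k
      using that
    proof (induction k)
      case (Suc k)
      have "cutoff R (fst (orbit \<tau> R \<xi> k)) = 1"
        using x_le[of k] Suc.prems by (simp add: cutoff_def)
      then show ?case using E_step[of \<xi> k] Suc by (simp add: algebra_simps add_divide_distrib)
    qed simp
    from this[of n] have "b \<le> E \<xi> 0 - real n * (\<tau> * (\<delta> / 2))" using \<open>E \<xi> n \<ge> b\<close> by simp
    also have "E \<xi> 0 \<le> T * (C * norm \<xi>)" by (simp add: E_def energy_zero_le)
    also have "\<dots> \<le> T * (C * R)"
      using x_le[of 0] T_pos C_nonneg by (intro mult_left_mono) auto
    finally show False using n by linarith
  qed
  then show ?thesis by (rule that)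
qed

lemma traj_lipschitz:
  assumes y: "admissible y" and t: "s \<in> {0..T}" "t \<in> {0..T}"
  shows "norm (traj x y t - traj x y s) \<le> a * \<bar>t - s\<bar>"
proof -
  note yc = y[unfolded admissible_def, THEN conjunct1]
  have *: "norm (traj x y t - traj x y s) \<le> a * (t - s)" if "s \<le> t" "s \<in> {0..T}" "t \<in> {0..T}" for s t
  proof -
    have "integral {0..s} y + integral {s..t} y = integral {0..t} y"
      by (rule Henstock_Kurzweil_Integration.integral_combine)
         (use that in \<open>auto intro!: integrable_continuous_real continuous_on_subset[OF yc]\<close>)
    moreover have "norm (integral {s..t} y) \<le> a * (t - s)"
      using that y by (intro integral_bound continuous_on_subset[OF yc]) (auto simp: admissible_def)
    ultimately show ?thesis by (simp add: traj_def flip: \<open>_ = integral {0..t} y\<close>)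
  qed
  show ?thesis using *[of s t] *[of t s] t by (cases "s \<le> t") (auto simp: norm_minus_commute)
qed

lemma norm_integral_diff_target_le:
  assumes e: "e > 0"
  obtains K where "K \<ge> 0" "\<And>x y t. admissible y \<Longrightarrow> t \<in> {0..T} \<Longrightarrow>
    norm (integral {0..t} (\<lambda>r. y r - target x y r)) \<le> e * T + K * gap x y"
proof -
  let ?B = "(2 * a * (2 * C * T) - \<Phi>min) / a + 2 * C * T"
  obtain K where K: "K \<ge> 0" "\<And>x p. norm x \<le> a \<Longrightarrow> norm p \<le> ?B \<Longrightarrow>
      norm (x - \<psi> p) \<le> e + K * bregman x (\<psi> p)"
    using dist_le_bregman[OF e] by blast
  have "norm (integral {0..t} (\<lambda>r. y r - target x y r)) \<le> e * T + K * gap x y"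
    if y: "admissible y" and t: "t \<in> {0..T}" for x y t
  proof -
    note yc = y[unfolded admissible_def, THEN conjunct1]
    have ya: "norm (y r) \<le> a" if "r \<in> {0..T}" for r using y that by (auto simp: admissible_def)
    let ?z = "target x y"
    have sub: "{0..t} \<subseteq> {0..T}" using t by auto
    have ineq: "norm (y r - ?z r) \<le> e + K * bregman (y r) (?z r)" if r: "r \<in> {0..T}" for r
    proof -
      have "norm (multiplier (load x y) - load x y r) \<le> ?B"
        using norm_multiplier_le[OF load_cont[OF yc] norm_load_le[OF yc]] norm_load_le[OF yc r, of x]
        by (intro order_trans[OF norm_triangle_ineq4] add_mono) auto
      then show ?thesis unfolding target_def by (rule K(2)[OF ya[OF r]])
    qed
    have c: "continuous_on {0..T} (\<lambda>r. e + K * bregman (y r) (?z r))"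
      by (intro continuous_intros bregman_cont y)
    have pos: "0 \<le> e + K * bregman (y r) (?z r)" if "r \<in> {0..T}" for r
      using ineq[OF that] norm_ge_zero order_trans by blast
    have "norm (integral {0..t} (\<lambda>r. y r - ?z r)) \<le> integral {0..t} (\<lambda>r. e + K * bregman (y r) (?z r))"
      using sub
      by (intro integral_norm_bound_integral integrable_continuous_real continuous_intros ineq
          continuous_on_subset[OF c] continuous_on_subset[OF yc] continuous_on_subset[OF target_cont[OF yc]]) auto
    also have "\<dots> \<le> integral {0..T} (\<lambda>r. e + K * bregman (y r) (?z r))"
      by (intro integral_subset_le sub integrable_continuous_real c continuous_on_subset[OF c sub] ballI pos)
    also have "\<dots> = e * T + K * integral {0..T} (\<lambda>r. bregman (y r) (?z r))"
      using T_pos bregman_cont[OF y, of x]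
      by (subst integral_add) (auto intro!: integrable_continuous_real continuous_intros)
    also have "\<dots> \<le> e * T + K * gap x y"
      using K(1) by (intro add_left_mono mult_left_mono) (auto simp: gap_def)
    finally show ?thesis .
  qed
  then show ?thesis using that K(1) by blast
qed

theorem critical_point_exists:
  obtains u q where "integral {0..T} (\<lambda>t. gradF t (u t)) = 0" "subgrad (u T - u 0) (- q)"
    "continuous_on {0..T} u"
    "\<And>t. t \<in> {0..T} \<Longrightarrow>
      (u has_vector_derivative \<psi> (q - integral {0..t} (\<lambda>s. gradF s (u s)))) (at t within {0..T})"
proof -
  obtain R where R: "\<And>\<delta>. \<delta> > 0 \<Longrightarrow> \<exists>x y. admissible y \<and> norm x \<le> R \<and> gap x y < \<delta>"
    using small_gap_exists by blast
  have "\<forall>n. \<exists>x y. admissible y \<and> norm x \<le> R \<and> gap x y < 1 / real (Suc n)"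
    using R by simp
  then obtain x0 y0 where y0: "\<And>n. admissible (y0 n)" and x0: "\<And>n. norm (x0 n) \<le> R"
    and gap0: "\<And>n. gap (x0 n) (y0 n) < 1 / real (Suc n)"
    by metis
  have bd: "norm (traj (x0 n) (y0 n) t) \<le> R + a * T" if "t \<in> {0..T}" for n t
    unfolding traj_def by (intro norm_triangle_mono x0 norm_traj_diff_le y0 that)
  have eq: "\<exists>d. 0 < d \<and> (\<forall>n s. s \<in> {0..T} \<and> norm (t - s) < d \<longrightarrow>
      norm (traj (x0 n) (y0 n) t - traj (x0 n) (y0 n) s) < e)" if t: "t \<in> {0..T}" "0 < e" for t e
  proof (intro exI conjI allI impI)
    show "0 < e / a" using t a_pos by simp
    fix n s assume s: "s \<in> {0..T} \<and> norm (t - s) < e / a"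
    have "norm (traj (x0 n) (y0 n) t - traj (x0 n) (y0 n) s) \<le> a * \<bar>t - s\<bar>"
      using s t by (intro traj_lipschitz y0) auto
    also have "\<dots> < e" using s a_pos by (simp add: pos_less_divide_eq mult.commute)
    finally show "norm (traj (x0 n) (y0 n) t - traj (x0 n) (y0 n) s) < e" .
  qed
  obtain u k where u: "continuous_on {0..T} u" and k: "strict_mono (k :: nat \<Rightarrow> nat)"
    and lim0: "\<And>e. 0 < e \<Longrightarrow> \<exists>N. \<forall>n t. n \<ge> N \<and> t \<in> {0..T} \<longrightarrow>
      norm (traj (x0 (k n)) (y0 (k n)) t - u t) < e"
    by (rule Arzela_Ascoli[of "{0..T}" "\<lambda>n. traj (x0 n) (y0 n)", OF compact_Icc bd eq]) (assumption | rule that)+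
  define x y where "x n = x0 (k n)" and "y n = y0 (k n)" for n
  have y: "admissible (y n)" and yc: "continuous_on {0..T} (y n)" for n
    using y0 by (auto simp: y_def admissible_def)
  have lim: "uniform_limit {0..T} (\<lambda>n. traj (x n) (y n)) u sequentially"
    unfolding uniform_limit_sequentially_iff x_def y_def dist_norm
  proof (intro allI impI)
    fix e :: real assume "e > 0"
    from lim0[OF this]
    show "\<exists>N. \<forall>n\<ge>N. \<forall>t\<in>{0..T}. norm (traj (x0 (k n)) (y0 (k n)) t - u t) < e" by blast
  qed
  have gap: "(\<lambda>n. gap (x n) (y n)) \<longlonglongrightarrow> 0"
  proof -
    have "(\<lambda>n. gap (x0 n) (y0 n)) \<longlonglongrightarrow> 0"
      using gap0 gap_nonneg[OF y0]
      by (intro tendsto_sandwich[OF _ _ tendsto_const LIMSEQ_inverse_real_of_nat])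
         (auto simp: inverse_eq_divide less_imp_le)
    from LIMSEQ_subseq_LIMSEQ[OF this k] show ?thesis by (simp add: x_def y_def o_def)
  qed
  let ?h = "\<lambda>t. gradF t (u t)"
  let ?c = "integral {0..T} ?h"
  let ?H = "\<lambda>t. integral {0..t} ?h - (t / T) *\<^sub>R ?c"
  let ?q = "multiplier ?H" and ?Y = "\<lambda>t. \<psi> (multiplier ?H - ?H t)"
  have c: "?c = 0"
  proof -
    have "(\<lambda>n. (norm (total_force (x n) (y n)))\<^sup>2) \<longlonglongrightarrow> (norm ?c)\<^sup>2"
      by (intro tendsto_intros tendsto_total_force yc u lim)
    moreover have "(\<lambda>n. (norm (total_force (x n) (y n)))\<^sup>2) \<longlonglongrightarrow> 0"
    proof (rule tendsto_sandwich[OF _ _ tendsto_const gap])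
      have "(norm (total_force (x n) (y n)))\<^sup>2 \<le> gap (x n) (y n)" for n
        unfolding gap_def using y
        by (auto intro!: integral_nonneg integrable_continuous_real bregman_cont bregman_nonneg
            norm_target_less simp: admissible_def)
      then show "\<forall>\<^sub>F n in sequentially. (norm (total_force (x n) (y n)))\<^sup>2 \<le> gap (x n) (y n)" by simp
    qed simp
    ultimately have "(norm ?c)\<^sup>2 = 0" by (rule LIMSEQ_unique)
    then show ?thesis by simp
  qed
  have Hc: "continuous_on {0..T} ?H" by (rule limit_load_cont[OF yc u lim])
  have Yc: "continuous_on {0..T} ?Y" by (intro \<psi>_load_cont Hc)
  have u_eq: "u t = u 0 + integral {0..t} ?Y" if t: "t \<in> {0..T}" for t
  proof -
    have A: "(\<lambda>n. integral {0..t} (target (x n) (y n))) \<longlonglongrightarrow> integral {0..t} ?Y"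
      by (rule tendsto_uniform_limitI[OF uniform_limit_indefinite_integral[OF T_nonneg _ Yc] t])
         (intro target_cont yc uniform_limit_target u lim)+
    have B: "(\<lambda>n. integral {0..t} (\<lambda>r. y n r - target (x n) (y n) r)) \<longlonglongrightarrow> 0"
    proof (rule LIMSEQ_I)
      fix e :: real assume e: "e > 0"
      then have "e / (2 * T) > 0" using T_pos by simp
      then obtain K where "K \<ge> 0" and K: "\<And>x y t. admissible y \<Longrightarrow> t \<in> {0..T} \<Longrightarrow>
          norm (integral {0..t} (\<lambda>r. y r - target x y r)) \<le> e / (2 * T) * T + K * gap x y"
        using norm_integral_diff_target_le[of "e / (2 * T)"] by blast
      have K': "norm (integral {0..t} (\<lambda>r. y n r - target (x n) (y n) r)) \<le> e / 2 + K * gap (x n) (y n)" for n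
        using K[OF y t, of n "x n"] T_pos by simp
      have "(\<lambda>n. K * gap (x n) (y n)) \<longlonglongrightarrow> K * 0" by (intro tendsto_intros gap)
      then have "\<forall>\<^sub>F n in sequentially. K * gap (x n) (y n) < e / 2"
        using e by (intro order_tendstoD) auto
      then have "\<forall>\<^sub>F n in sequentially.
          norm (integral {0..t} (\<lambda>r. y n r - target (x n) (y n) r) - 0) < e"
      proof (rule eventually_mono)
        fix n assume "K * gap (x n) (y n) < e / 2"
        with K'[of n] show "norm (integral {0..t} (\<lambda>r. y n r - target (x n) (y n) r) - 0) < e"
          by (simp only: diff_zero)
      qed
      then show "\<exists>N. \<forall>n\<ge>N. norm (integral {0..t} (\<lambda>r. y n r - target (x n) (y n) r) - 0) < e"
        by (simp add: eventually_sequentially)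
    qed
    have P: "(\<lambda>n. traj (x n) (y n) s) \<longlonglongrightarrow> u s" if "s \<in> {0..T}" for s
      by (rule tendsto_uniform_limitI[OF lim that])
    have traj_eq: "traj (x n) (y n) t = traj (x n) (y n) 0 + (integral {0..t} (\<lambda>r. y n r - target (x n) (y n) r)
        + integral {0..t} (target (x n) (y n)))" for n
    proof -
      have "continuous_on {0..t} (y n)" "continuous_on {0..t} (target (x n) (y n))"
        using t by (auto intro: continuous_on_subset[OF yc] continuous_on_subset[OF target_cont[OF yc]])
      then show ?thesis by (simp add: traj_def integral_diff integrable_continuous_real)
    qed
    have "(\<lambda>n. traj (x n) (y n) t) \<longlonglongrightarrow> u 0 + (0 + integral {0..t} ?Y)"
      unfolding traj_eq using T_nonneg by (intro tendsto_add P A B) simp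
    from LIMSEQ_unique[OF P[OF t] this] show ?thesis by simp
  qed
  have H_eq: "?H = (\<lambda>t. integral {0..t} ?h)" by (simp add: c)
  show ?thesis
  proof (rule that[of u ?q])
    have "integral {0..T} ?Y = u T - u 0" using u_eq[of T] T_nonneg by simp
    then show "subgrad (u T - u 0) (- ?q)"
      using multiplier[OF Hc] by (simp add: displacement_def)
    fix t assume t: "t \<in> {0..T}"
    have "((\<lambda>t. u 0 + integral {0..t} ?Y) has_vector_derivative 0 + ?Y t) (at t within {0..T})"
      by (intro has_vector_derivative_add has_vector_derivative_const integral_has_vector_derivative Yc t)
    then have "(u has_vector_derivative 0 + ?Y t) (at t within {0..T})"
      by (rule has_vector_derivative_transform[OF t, rotated]) (rule u_eq)
    then show "(u has_vector_derivative \<psi> (?q - integral {0..t} ?h)) (at t within {0..T})"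
      using H_eq by (simp add: c)
  qed (use c u in auto)
qed

end

section \<open>The boundary value problem\<close>

lemma open_superlevel_lsc:
  assumes "lower_semicontinuous f"
  shows "open {x. y < f x}"
proof (subst open_subopen, rule ballI)
  fix x assume "x \<in> {x. y < f x}"
  then have x: "y < f x" by simp
  have "f x \<le> Liminf (at x) f" using assms by (simp add: lower_semicontinuous_def)
  then have "\<forall>\<^sub>F z in at x. y < f z" using x by (simp add: le_Liminf_iff)
  then obtain S where "open S" "x \<in> S" "\<forall>z\<in>S. z \<noteq> x \<longrightarrow> y < f z"
    unfolding eventually_at_topological by auto
  then show "\<exists>S. open S \<and> x \<in> S \<and> S \<subseteq> {x. y < f x}"
    using x by (intro exI[of _ S]) auto
qed

lemma closed_epigraph_lsc:
  assumes "lower_semicontinuous f"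
  shows "closed {z. f (fst z) \<le> ereal (snd z)}"
proof -
  have "- {z. f (fst z) \<le> ereal (snd z)} = (\<Union>y. {x. ereal y < f x} \<times> {..<y})"
  proof (rule set_eqI, rule iffI)
    fix z assume "z \<in> - {z. f (fst z) \<le> ereal (snd z)}"
    then obtain y where "ereal (snd z) < ereal y" "ereal y < f (fst z)"
      using ereal_dense2[of "ereal (snd z)" "f (fst z)"] by (auto simp: not_le)
    then show "z \<in> (\<Union>y. {x. ereal y < f x} \<times> {..<y})" by (cases z) auto
  next
    fix z assume "z \<in> (\<Union>y. {x. ereal y < f x} \<times> {..<y})"
    then obtain y where "ereal y < f (fst z)" "ereal (snd z) < ereal y" by (cases z) auto
    then have "ereal (snd z) < f (fst z)" by (rule less_trans[rotated])
    then show "z \<in> - {z. f (fst z) \<le> ereal (snd z)}" by simp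
  qed
  then have "open (- {z. f (fst z) \<le> ereal (snd z)})"
    by (simp add: open_UN open_Times open_superlevel_lsc[OF assms])
  then show ?thesis by (simp add: closed_def)
qed

lemma convex_lsc_le_along_zero_line:
  fixes f :: "'a::real_normed_vector \<Rightarrow> ereal"
  assumes conv: "ereal_convex f" and lsc: "lower_semicontinuous f"
    and zero: "\<And>r::real. f (r *\<^sub>R d) = 0" and nonneg: "0 \<le> f z"
  shows "f (z + d) \<le> f z"
proof (rule ccontr)
  assume "\<not> f (z + d) \<le> f z"
  then have less: "f z < f (z + d)" by simp
  let ?p = "\<lambda>s::real. (1 - s) *\<^sub>R z + s *\<^sub>R ((1 / s) *\<^sub>R d)"
  have "((\<lambda>s::real. (1 - s) *\<^sub>R z + d) \<longlongrightarrow> (1 - 0) *\<^sub>R z + d) (at_right 0)"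
    by (intro tendsto_intros)
  then have "\<forall>\<^sub>F s in at_right (0::real). (1 - s) *\<^sub>R z + d \<in> {x. f z < f x}"
    by (rule topological_tendstoD) (use open_superlevel_lsc[OF lsc] less in auto)
  moreover have "\<forall>\<^sub>F s in at_right (0::real). s \<in> {0<..<1}"
    by (rule eventually_at_right_real) simp
  ultimately have "\<forall>\<^sub>F s in at_right (0::real). False"
  proof eventually_elim
    case (elim s)
    have "f (?p s) \<le> ereal (1 - s) * f z + ereal s * f ((1 / s) *\<^sub>R d)"
      using conv[unfolded ereal_convex_def, rule_format, of "1 - s" s z "(1 / s) *\<^sub>R d"] elim(2) by simp
    also have "\<dots> = ereal (1 - s) * f z" by (simp add: zero)
    also have "\<dots> \<le> 1 * f z"
      using elim(2) nonneg by (intro ereal_mult_right_mono) auto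
    finally show False using elim by simp
  qed
  then show False by simp
qed

theorem theorem4p12:
  fixes T a :: real
    and \<phi> :: "real^'n \<Rightarrow> real^'n" and \<Phi> :: "real^'n \<Rightarrow> real"
    and F :: "real \<Rightarrow> real^'n \<Rightarrow> real" and gradF :: "real \<Rightarrow> real^'n \<Rightarrow> real^'n"
    and j :: "(real^'n) \<times> (real^'n) \<Rightarrow> ereal"
  assumes "T > 0" and "a > 0"
    and "\<exists>\<psi>. homeomorphism (ball 0 a) UNIV \<phi> \<psi>"
    and "\<phi> 0 = 0"
    and "\<And>x. x \<in> cball 0 a \<Longrightarrow> \<Phi> x \<le> 0"
    and "\<And>x. x \<in> ball 0 a \<Longrightarrow> GDERIV \<Phi> x :> \<phi> x"
    and "continuous_on (ball 0 a) \<phi>"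
    and "continuous_on (cball 0 a) \<Phi>"
    and "strictly_convex_on (cball 0 a) \<Phi>"
    and "continuous_on ({0..T} \<times> UNIV) (\<lambda>(t, x). F t x)"
    and "\<And>t x. t \<in> {0..T} \<Longrightarrow> GDERIV (F t) x :> gradF t x"
    and "continuous_on ({0..T} \<times> UNIV) (\<lambda>(t, x). gradF t x)"
    and "\<And>t. t \<in> {0..T} \<Longrightarrow> F t 0 = 0"
    and "proper_fun j" and "ereal_convex j" and "lower_semicontinuous j"
    and "j 0 = 0" and "0 \<in> subdifferential j 0"
    and "\<And>x. j (x, x) = 0"
    and "\<exists>M::real. \<forall>z\<in>effective_domain j. \<bar>j z\<bar> \<le> ereal M"
    and "bounded ((\<lambda>(t, x). gradF t x) ` ({0..T} \<times> UNIV))"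
    and "filterlim (\<lambda>x. integral {0..T} (\<lambda>t. F t x)) at_top at_infinity"
  shows "\<exists>u. bvp_solution T a \<phi> gradF j u"
proof -
  note conv = \<open>ereal_convex j\<close> and lsc = \<open>lower_semicontinuous j\<close> and diag = \<open>\<And>x. j (x, x) = 0\<close>
  obtain \<psi> where \<psi>: "homeomorphism (ball 0 a) UNIV \<phi> \<psi>" using assms(3) by blast
  obtain C where C: "\<And>t x. t \<in> {0..T} \<Longrightarrow> norm (gradF t x) \<le> C"
    using \<open>bounded ((\<lambda>(t, x). gradF t x) ` ({0..T} \<times> UNIV))\<close> unfolding bounded_iff by fast
  obtain M where M: "\<And>z. z \<in> effective_domain j \<Longrightarrow> \<bar>j z\<bar> \<le> ereal M"
    using \<open>\<exists>M::real. \<forall>z\<in>effective_domain j. \<bar>j z\<bar> \<le> ereal M\<close> by blast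
  have j_nonneg: "0 \<le> j z" for z
  proof -
    have "j 0 + ereal (0 \<bullet> (z - 0)) \<le> j z"
      using \<open>0 \<in> subdifferential j 0\<close> unfolding subdifferential_def by blast
    then show ?thesis unfolding \<open>j 0 = 0\<close> inner_zero_left by (simp only: zero_ereal_def[symmetric] add_0)
  qed
  have j_le: "j (z + (c, c)) \<le> j z" for z c
    using convex_lsc_le_along_zero_line[OF conv lsc _ j_nonneg, of "(c, c)"] diag by simp
  have j_eq: "j (x, y) = j (0, y - x)" for x y
    using j_le[of "(x, y)" "- x"] j_le[of "(0, y - x)" x] by (intro antisym) auto
  define D where "D = {w. j (0, w) < \<infinity>}"
  define J where "J w = real_of_ereal (j (0, w))" for w
  have ereal_J: "j (0, w) = ereal (J w)" if "w \<in> D" for w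
    using that j_nonneg[of "(0, w)"] by (cases "j (0, w)") (auto simp: D_def J_def)
  have D_J_I: "w \<in> D \<and> J w \<le> r" if "j (0, w) \<le> ereal r" for w r
    using that j_nonneg[of "(0, w)"] by (cases "j (0, w)") (auto simp: D_def J_def)
  have J_conv: "s *\<^sub>R w + t *\<^sub>R v \<in> D \<and> J (s *\<^sub>R w + t *\<^sub>R v) \<le> s * J w + t * J v"
    if "w \<in> D" "v \<in> D" "s > 0" "t > 0" "s + t = 1" for w v s t
  proof (rule D_J_I)
    have "j (s *\<^sub>R (0, w) + t *\<^sub>R (0, v)) \<le> ereal s * j (0, w) + ereal t * j (0, v)"
      using conv that(3-5) unfolding ereal_convex_def by blast
    then show "j (0, s *\<^sub>R w + t *\<^sub>R v) \<le> ereal (s * J w + t * J v)"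
      by (simp add: ereal_J that(1,2))
  qed
  interpret lsc_convex_cost D J M
  proof
    have "closed ((\<lambda>z. ((0, fst z), snd z)) -` {z. j (fst z) \<le> ereal (snd z)})"
      by (rule closed_vimage[OF closed_epigraph_lsc[OF lsc]]) (intro continuous_intros)
    moreover have "(\<lambda>z. ((0, fst z), snd z)) -` {z. j (fst z) \<le> ereal (snd z)} = {(w, r). w \<in> D \<and> J w \<le> r}"
      by (auto dest: D_J_I) (simp add: ereal_J)
    ultimately show "closed {(w, r). w \<in> D \<and> J w \<le> r}" by simp
    show "convex_on D J"
    proof (rule convex_onI)
      show "J ((1 - t) *\<^sub>R x + t *\<^sub>R y) \<le> (1 - t) * J x + t * J y"
        if "0 < t" "t < 1" "x \<in> D" "y \<in> D" for t x y
        using J_conv[of x y "1 - t" t] that by simp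
      show "convex D"
      proof (rule convexI)
        fix x y and s t :: real assume *: "x \<in> D" "y \<in> D" "0 \<le> s" "0 \<le> t" "s + t = 1"
        then consider "s = 0" "t = 1" | "t = 0" "s = 1" | "s > 0" "t > 0" by linarith
        then show "s *\<^sub>R x + t *\<^sub>R y \<in> D"
          using J_conv[of x y s t] * by cases auto
      qed
    qed
    show "0 \<in> D" "J 0 = 0" using diag[of 0] by (auto simp: D_def J_def)
    show "0 \<le> J w" if "w \<in> D" for w using j_nonneg[of "(0, w)"] by (simp add: J_def real_of_ereal_pos)
    show "J w \<le> M" if "w \<in> D" for w
    proof -
      have "(0, w) \<in> effective_domain j" using that by (simp add: effective_domain_def D_def)
      from M[OF this] show ?thesis by (simp add: ereal_J[OF that])
    qed
  qed
  interpret forced_boundary_problem a \<phi> \<psi> \<Phi> D J M T F gradF C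
    by unfold_locales (use assms \<psi> C in auto)
  obtain u q where total: "integral {0..T} (\<lambda>t. gradF t (u t)) = 0"
    and sub: "subgrad (u T - u 0) (- q)" and uc: "continuous_on {0..T} u"
    and u': "\<And>t. t \<in> {0..T} \<Longrightarrow>
      (u has_vector_derivative \<psi> (q - integral {0..t} (\<lambda>s. gradF s (u s)))) (at t within {0..T})"
    using critical_point_exists by blast
  let ?p = "\<lambda>t. q - integral {0..t} (\<lambda>s. gradF s (u s))"
  have p': "(?p has_vector_derivative - gradF t (u t)) (at t within {0..T})" if "t \<in> {0..T}" for t
    using that gradF_cont_compose[OF uc]
    by (auto intro!: derivative_eq_intros integral_has_vector_derivative)
  have pair: "(q, - q) \<in> subdifferential j (u 0, u T)"
    unfolding subdifferential_def
  proof safe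
    fix y1 y2
    show "j (u 0, u T) + ereal ((q, - q) \<bullet> ((y1, y2) - (u 0, u T))) \<le> j (y1, y2)"
    proof (cases "y2 - y1 \<in> D")
      case True
      then have "J (y2 - y1) \<ge> J (u T - u 0) + - q \<bullet> ((y2 - y1) - (u T - u 0))"
        using sub by (auto simp: subgrad_def)
      then have "J (u T - u 0) + (q, - q) \<bullet> ((y1, y2) - (u 0, u T)) \<le> J (y2 - y1)"
        by (simp add: inner_diff_right)
      moreover have "u T - u 0 \<in> D" using sub by (simp add: subgrad_def)
      ultimately show ?thesis
        using True by (simp add: j_eq[of "u 0"] j_eq[of y1] ereal_J)
    next
      case False
      then show ?thesis by (simp add: j_eq[of y1] D_def)
    qed
  qed
  have "\<phi> (\<psi> (?p 0)) = q" "\<phi> (\<psi> (?p T)) = q"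
    by (simp_all add: \<phi>_\<psi> total)
  then have boundary: "(\<phi> (\<psi> (?p 0)), - \<phi> (\<psi> (?p T))) \<in> subdifferential j (u 0, u T)"
    using pair by (simp only:)
  have "C1_with_derivative T u (\<lambda>t. \<psi> (?p t))"
    unfolding C1_with_derivative_def
    by (intro conjI ballI u' \<psi>_continuous_compose continuous_on_vector_derivative[OF p'])
  moreover have "C1_with_derivative T (\<lambda>t. \<phi> (\<psi> (?p t))) (\<lambda>t. - gradF t (u t))"
    unfolding C1_with_derivative_def \<phi>_\<psi>
    by (intro conjI ballI p' continuous_intros gradF_cont_compose uc)
  moreover have "subdifferential j (u 0, u T) \<noteq> {}" using pair by blast
  ultimately have "bvp_solution T a \<phi> gradF j u"
    unfolding bvp_solution_def
    by (intro exI[of _ "\<lambda>t. \<psi> (?p t)"] exI[of _ "\<lambda>t. - gradF t (u t)"] conjI ballI \<psi>_ball boundary)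
       (assumption | rule minus_minus)+
  then show ?thesis by blast
qed

end
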